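(* Let $\beta\ge 1$ be fixed. For each $n$, let $A_n$ be a random $n\times n$ matrix whose eigenvalues are those of the Gaussian $\beta$-ensemble of size $n$ scaled by the factor $\frac{1}{2\sqrt{n\beta}}$. Let $(p_n)$ be a sequence of positive integers with $p_n\to\infty$ as $n\to\infty$ and $p_n=O(n^{2/3-\epsilon})$ for some $\epsilon>0$. Then, as $n\to\infty$, $$\mathbb{E}\big(\mathrm{Tr}\,A_n^{p_n}\big)=\begin{cases}2^{3/2}\,n\,(\pi p_n^3)^{-1/2}\,(1+o(1)) & \text{if } p_n \text{ is even},\\ 0 & \text{if } p_n \text{ is odd}.\end{cases}$$
   Context: The Gaussian $\beta$-ensemble of size $n$ is the probability distribution of $(\lambda_1,\dots,\lambda_n)\in\mathbb{R}^n$ with density $$G_{n,\beta}\prod_{1\le i<j\le n}|\lambda_i-\lambda_j|^\beta\exp\Big(-\frac14\sum_{i=1}^n\lambda_i^2\Big)$$ with respect to Lebesgue measure, where $G_{n,\beta}$ is the normalization constant. (Equivalently, it is the eigenvalue distribution of the $n\times n$ real symmetric tridiagonal random matrix with independent entries on and above the diagonal, with diagonal entries of law $N(0,2)$ (mean $0$, variance $2$) and with $(j,j+1)$ entry of law $\chi_{(n-j)\beta}$ for $1\le j\le n-1$.) Thus $\mathrm{Tr}\,A_n^{p}=\sum_{i=1}^n\big(\lambda_i/(2\sqrt{n\beta})\big)^{p}$. *)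

theory Defs
  imports
    "HOL-Probability.Probability"
    "HOL-Library.Landau_Symbols"
    "Jordan_Normal_Form.Char_Poly"
begin

text \<open>
  Points of \<open>\<real>\<^sup>n\<close> are functions \<^typ>\<open>nat \<Rightarrow> real\<close> on the
  index set \<open>{..<n}\<close> (indices start at 0), with the product \<open>\<sigma>\<close>-algebra.
\<close>

definition beta_weight :: "nat \<Rightarrow> real \<Rightarrow> (nat \<Rightarrow> real) \<Rightarrow> real" where
  "beta_weight n \<beta> x =
     (\<Prod>j<n. \<Prod>i<j. \<bar>x i - x j\<bar> powr \<beta>) * exp (- (1/4) * (\<Sum>i<n. (x i)\<^sup>2))"

definition beta_normalization :: "nat \<Rightarrow> real \<Rightarrow> real" where
  "beta_normalization n \<beta> = 1 / (LINT x|PiM {..<n} (\<lambda>_. lborel). beta_weight n \<beta> x)"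

definition gaussian_beta_ensemble :: "nat \<Rightarrow> real \<Rightarrow> (nat \<Rightarrow> real) measure" where
  "gaussian_beta_ensemble n \<beta> =
     density (PiM {..<n} (\<lambda>_. lborel)) (\<lambda>x. ennreal (beta_normalization n \<beta> * beta_weight n \<beta> x))"

definition scaled_gaussian_beta_ensemble :: "nat \<Rightarrow> real \<Rightarrow> (nat \<Rightarrow> real) measure" where
  "scaled_gaussian_beta_ensemble n \<beta> =
     distr (gaussian_beta_ensemble n \<beta>) (PiM {..<n} (\<lambda>_. borel))
       (\<lambda>x. \<lambda>i\<in>{..<n}. x i / (2 * sqrt (real n * \<beta>)))"

definition random_matrix :: "'a measure \<Rightarrow> nat \<Rightarrow> ('a \<Rightarrow> complex mat) \<Rightarrow> bool" where
  "random_matrix M n A \<longleftrightarrow>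
     (\<forall>\<omega>\<in>space M. A \<omega> \<in> carrier_mat n n) \<and>
     (\<forall>i<n. \<forall>j<n. (\<lambda>\<omega>. A \<omega> $$ (i, j)) \<in> borel_measurable M)"

definition permutation_invariant :: "nat \<Rightarrow> (nat \<Rightarrow> real) set \<Rightarrow> bool" where
  "permutation_invariant n B \<longleftrightarrow> (\<forall>\<pi>. \<pi> permutes {..<n} \<longrightarrow> (\<forall>x\<in>B. x \<circ> \<pi> \<in> B))"

text \<open>
  The eigenvalues of a random matrix, counted with algebraic multiplicity, carry no
  intrinsic order, so their law is the law of an unordered \<open>n\<close>-tuple: for any
  measurable enumeration \<open>x\<close> of the (almost surely real) spectrum, only the
  probabilities of permutation-invariant Borel sets are prescribed by the law \<open>Q\<close>.
  This covers both exchangeable and increasing enumerations.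
\<close>

definition eigenvalues_have_law ::
  "'a measure \<Rightarrow> nat \<Rightarrow> ('a \<Rightarrow> complex mat) \<Rightarrow> (nat \<Rightarrow> real) measure \<Rightarrow> bool" where
  "eigenvalues_have_law M n A Q \<longleftrightarrow>
     (\<exists>x. x \<in> measurable M (PiM {..<n} (\<lambda>_. borel)) \<and>
          (AE \<omega> in M. char_poly (A \<omega>) = (\<Prod>i<n. [:- complex_of_real (x \<omega> i), 1:])) \<and>
          (\<forall>B\<in>sets (PiM {..<n} (\<lambda>_. borel)). permutation_invariant n B \<longrightarrow>
             emeasure M (x -` B \<inter> space M) = emeasure Q B))"

definition mat_trace :: "complex mat \<Rightarrow> complex" where
  "mat_trace A = (\<Sum>i<dim_row A. A $$ (i, i))"

end

theory Submission
  imports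
    Defs
    "HOL-Real_Asymp.Real_Asymp"
    "Jordan_Normal_Form.Schur_Decomposition"
begin

text \<open>
  Let \<open>\<tau>\<^sub>l(x) = (1/n) \<Sum>\<^sub>i (x\<^sub>i / (2 \<surd>(n\<beta>)))\<^sup>l\<close> and \<open>T(L) = E(\<Prod>\<^sub>l \<tau>\<^sub>l)\<close> for a multiset \<open>L\<close>.
  Integration by parts against the density gives the loop equations
  \<open>4 T(k+1, L) = \<Sum>\<^sub>a T(a, k-1-a, L) + (2/\<beta> - 1) (k/n) T(k-1, L) + (2/\<beta>) n\<^sup>-\<^sup>2 \<Sum>\<^sub>l l T(k+l-1, L - l)\<close>,
  the sums being over \<open>a < k\<close> and \<open>l \<in> L\<close>. Without the last two terms the solution is
  the product of the semicircle moments \<open>c\<^sub>l\<close>. For \<open>\<beta> \<ge> 1\<close> the coefficients are at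
  most 1 and 2 in absolute value, so if \<open>v \<ge> c\<close> is such that \<open>\<Prod> v\<^sub>l\<close> is a
  supersolution of the recursion with these constants, then by induction on the degree
  \<open>\<bar>T(L) - \<Prod> c\<^sub>l\<bar> \<le> \<Prod> v\<^sub>l - \<Prod> c\<^sub>l\<close>. The supersolution property of a product reduces
  to a recursion for the single sequence \<open>v\<close>, and up to degree \<open>N\<close> with
  \<open>N\<^sup>3\<^sup>/\<^sup>2 log\<^sup>2 N \<ll> n\<close> it is solved by \<open>v = c + 2/n\<close> on even indices and a suitable small
  sequence on odd ones. Since \<open>c\<^sub>p\<close> is of order \<open>p\<^sup>-\<^sup>3\<^sup>/\<^sup>2\<close>, the relative error of the moment of order
  \<open>p\<close> is \<open>O(p\<^sup>3\<^sup>/\<^sup>2 / n)\<close>. For odd total degree the recursion gives \<open>T(L) = 0\<close>.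
\<close>

section \<open>Normalised Catalan numbers\<close>

text \<open>The recursion linearised at \<open>scat\<close> is critical: \<open>cbin\<close> solves
  \<open>4 * y (Suc m) = 2 * (\<Sum>i\<le>m. scat i * y (m - i))\<close> exactly, so errors are not
  damped and a supersolution lives on small gains. A constant shift r of the even entries gains
  \<open>4 * r * cbin (Suc m)\<close>, because the partial sums of \<open>scat\<close> fall short of
  2 by \<open>2 * cbin (Suc m)\<close>. This has order r / sqrt m, and the source
  \<open>k / n * scat m\<close> at \<open>k = 2 * m + 1\<close> has order 1 / (n sqrt m): hence r is
  a multiple of 1/n. Errors of order \<open>N * \<Lambda>\<^sup>2 / n\<^sup>2\<close>, with
  \<open>\<Lambda> = 1 + harm N\<close>, must stay below 1 / (n sqrt N), which is the size
  condition. Odd entries have leading order 0 but cannot be 0 in \<open>v\<close>: two odd blocks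
  merge into an even one, which costs a factor \<open>v (k + l - 1) / v l\<close>. Small odd entries
  make this factor large, large ones spoil the even recursion through products of two odd entries;
  the balance is an odd size of order sqrt N / n.\<close>

text \<open>
  \<open>cbin m\<close> is the central binomial coefficient \<open>binom(2m, m) / 4\<^sup>m\<close> and \<open>scat m\<close> the
  Catalan number \<open>C\<^sub>m / 4\<^sup>m\<close>, the \<open>2m\<close>-th moment of the semicircle law on \<open>[-1, 1]\<close>.
\<close>

definition cbin :: "nat \<Rightarrow> real" where
  "cbin m = (- 1) ^ m * ((- 1/2) gchoose m)"

definition scat :: "nat \<Rightarrow> real" where
  "scat m = cbin m / (real m + 1)"

lemma cbin_0 [simp]: "cbin 0 = 1"
  by (simp add: cbin_def)

lemma cbin_Suc: "cbin (Suc m) = cbin m * (2 * real m + 1) / (2 * real m + 2)"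
proof -
  define a :: real where "a = - 1/2"
  have "a * (a gchoose m) = real m * (a gchoose m) + (1 + real m) * (a gchoose Suc m)"
    using gbinomial_mult_1[of a m] by simp
  then have "(1 + real m) * (a gchoose Suc m) = - (1/2) * (a gchoose m) - real m * (a gchoose m)"
    by (simp add: a_def)
  then have "2 * ((1 + real m) * (a gchoose Suc m)) = 2 * (- (1/2) * (a gchoose m) - real m * (a gchoose m))"
    by (simp only:)
  then have "(a gchoose Suc m) * (2 * real m + 2) = - (a gchoose m) * (2 * real m + 1)"
    by (simp add: algebra_simps)
  then have "(a gchoose Suc m) = - ((a gchoose m) * (2 * real m + 1) / (2 * real m + 2))"
    by (simp add: field_simps)
  then show ?thesis unfolding cbin_def a_def[symmetric] by simp
qed

lemma cbin_pos: "cbin m > 0"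
  by (induction m) (auto simp: cbin_Suc)

lemma scat_pos: "scat m > 0"
  by (simp add: scat_def cbin_pos)

lemma scat_0 [simp]: "scat 0 = 1"
  by (simp add: scat_def)

text \<open>As a discrete derivative of \<open>cbin\<close>, \<open>scat\<close> telescopes: its
  partial sums and convolutions reduce to those of \<open>cbin\<close>.\<close>

lemma scat_eq_diff: "scat m = 2 * (cbin m - cbin (Suc m))"
proof -
  have "2 * real m + 2 \<noteq> 0" "real m + 1 \<noteq> 0" by linarith+
  then show ?thesis
    by (simp add: scat_def cbin_Suc divide_simps) (simp add: algebra_simps)
qed

lemma cbin_Suc_le: "cbin (Suc m) \<le> cbin m"
  using scat_eq_diff[of m] scat_pos[of m] by simp

lemma cbin_le_double: "cbin m \<le> 2 * cbin (Suc m)"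
  using cbin_pos[of m] by (simp add: cbin_Suc field_simps)

lemma sum_scat: "(\<Sum>i\<le>m. scat i) = 2 - 2 * cbin (Suc m)"
  by (induction m) (simp_all add: scat_eq_diff)

lemma sum_cbin: "(\<Sum>i\<le>m. cbin i) = (2 * real m + 1) * cbin m"
proof (induction m)
  case (Suc m)
  have "(2 * real m + 1) * cbin m = (2 * real m + 2) * cbin (Suc m)"
    by (simp add: cbin_Suc)
  then show ?case using Suc by (simp add: algebra_simps)
qed simp

text \<open>The square of the series (1 - x)^(-1/2) is 1 / (1 - x): Vandermonde with both upper
  arguments -1/2 leaves \<open>(- 1) gchoose m\<close>, a sign.\<close>

lemma cbin_convolution: "(\<Sum>i\<le>m. cbin i * cbin (m - i)) = 1"
proof -
  have "(\<Sum>i\<le>m. cbin i * cbin (m - i)) =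
        (\<Sum>i\<le>m. (-1) ^ m * (((- 1/2) gchoose i) * ((- 1/2) gchoose (m - i))))"
    by (intro sum.cong refl) (simp add: cbin_def power_add[symmetric] mult_ac)
  also have "\<dots> = (-1) ^ m * ((- 1) gchoose m)"
    using gbinomial_Vandermonde[of "- 1/2 :: real" "- 1/2" m]
    by (simp add: sum_distrib_left[symmetric] atLeast0AtMost)
  also have "\<dots> = 1"
    by (simp add: gbinomial_minus[of 1 m] power_add[symmetric] flip: binomial_gbinomial)
  finally show ?thesis .
qed

lemma sum_rev_le: "(\<Sum>i\<le>m. f (m - i) i) = (\<Sum>i\<le>m::nat. f i (m - i))"
  by (rule sum.reindex_bij_witness[of _ "\<lambda>i. m - i" "\<lambda>i. m - i"]) auto

text \<open>This is the exactness of the linearised recursion at \<open>cbin\<close>. Writing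
  \<open>scat\<close> as a difference leaves two convolutions of \<open>cbin\<close>, a full one and
  one lacking its first term.\<close>

lemma scat_cbin_convolution: "(\<Sum>i\<le>m. scat i * cbin (m - i)) = 2 * cbin (Suc m)"
proof -
  have "1 = (\<Sum>i\<le>Suc m. cbin i * cbin (Suc m - i))"
    by (rule cbin_convolution[symmetric])
  also have "\<dots> = cbin (Suc m) + (\<Sum>i\<le>m. cbin (Suc i) * cbin (m - i))"
    by (subst sum.atMost_Suc_shift) simp
  finally have 1: "(\<Sum>i\<le>m. cbin (Suc i) * cbin (m - i)) = 1 - cbin (Suc m)" by simp
  have "(\<Sum>i\<le>m. scat i * cbin (m - i)) =
      2 * (\<Sum>i\<le>m. cbin i * cbin (m - i)) - 2 * (\<Sum>i\<le>m. cbin (Suc i) * cbin (m - i))"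
    by (simp add: scat_eq_diff algebra_simps sum_subtractf sum_distrib_left)
  then show ?thesis by (simp add: 1 cbin_convolution)
qed

text \<open>The Catalan recursion in the normalisation by \<open>4 ^ m\<close>. Only one factor is
  written as a difference, so that the convolution of \<open>scat\<close> with \<open>cbin\<close>
  applies at \<open>m\<close> and at \<open>Suc m\<close>.\<close>

lemma scat_convolution: "(\<Sum>i\<le>m. scat i * scat (m - i)) = 4 * scat (Suc m)"
proof -
  have 1: "(\<Sum>i\<le>m. scat i * cbin (Suc m - i)) = 2 * cbin (Suc (Suc m)) - scat (Suc m)"
    using scat_cbin_convolution[of "Suc m"] by simp
  have "(\<Sum>i\<le>m. scat i * scat (m - i)) =
     (\<Sum>i\<le>m. 2 * (scat i * cbin (m - i)) - 2 * (scat i * cbin (Suc m - i)))"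
    by (intro sum.cong refl) (subst (2) scat_eq_diff, simp add: Suc_diff_le algebra_simps)
  also have "\<dots> = 2 * (2 * cbin (Suc m)) - 2 * (2 * cbin (Suc (Suc m)) - scat (Suc m))"
    by (simp only: sum_subtractf sum_distrib_left[symmetric] 1 scat_cbin_convolution)
  also have "\<dots> = 4 * scat (Suc m)"
    using scat_eq_diff[of "Suc m"] by simp
  finally show ?thesis .
qed

lemma cbin_bounds:
  shows cbin_lower: "cbin m \<ge> 1 / (2 * sqrt (real m + 1))"
    and cbin_upper: "cbin m \<le> 1 / sqrt (real m + 1)"
proof -
  \<comment> \<open>The weight \<open>4 * m + 1\<close> makes the lower bound inductive; with
    \<open>4 * m + 4\<close>, the weight of the claimed bound, the product decreases in m.\<close>
  have 1: "(cbin m)\<^sup>2 * (4 * real m + 1) \<ge> 1 \<and> (cbin m)\<^sup>2 * (2 * real m + 1) \<le> 1"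
  proof (induction m)
    case (Suc m)
    let ?r = "real m"
    have e: "(cbin (Suc m))\<^sup>2 = (cbin m)\<^sup>2 * ((2 * ?r + 1)\<^sup>2 / (2 * ?r + 2)\<^sup>2)"
      by (simp add: cbin_Suc power_mult_distrib power_divide)
    have a: "(2 * ?r + 1)\<^sup>2 / (2 * ?r + 2)\<^sup>2 * (4 * ?r + 5) \<ge> 4 * ?r + 1"
      by (simp add: divide_simps add_pos_nonneg) (simp add: power2_eq_square algebra_simps)
    have b: "(2 * ?r + 1)\<^sup>2 / (2 * ?r + 2)\<^sup>2 * (2 * ?r + 3) \<le> 2 * ?r + 1"
      by (simp add: divide_simps add_pos_nonneg) (simp add: power2_eq_square algebra_simps)
    have "1 \<le> (cbin m)\<^sup>2 * (4 * ?r + 1)" using Suc by simp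
    also have "\<dots> \<le> (cbin m)\<^sup>2 * ((2 * ?r + 1)\<^sup>2 / (2 * ?r + 2)\<^sup>2 * (4 * ?r + 5))"
      by (intro mult_left_mono a) simp
    finally have A: "1 \<le> (cbin (Suc m))\<^sup>2 * (4 * real (Suc m) + 1)"
      by (simp add: e mult_ac add_ac)
    have "(cbin m)\<^sup>2 * ((2 * ?r + 1)\<^sup>2 / (2 * ?r + 2)\<^sup>2 * (2 * ?r + 3)) \<le> (cbin m)\<^sup>2 * (2 * ?r + 1)"
      by (intro mult_left_mono b) simp
    also have "\<dots> \<le> 1" using Suc by simp
    finally have B: "(cbin (Suc m))\<^sup>2 * (2 * real (Suc m) + 1) \<le> 1"
      by (simp add: e mult_ac add_ac)
    from A B show ?case by blast
  qed simp
  have "1 \<le> (cbin m)\<^sup>2 * (4 * real m + 1)" using 1 by simp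
  also have "\<dots> \<le> (cbin m)\<^sup>2 * (4 * (real m + 1))" by (intro mult_left_mono) auto
  also have "\<dots> = (cbin m * (2 * sqrt (real m + 1)))\<^sup>2"
    by (simp add: power_mult_distrib)
  finally have "1\<^sup>2 \<le> (cbin m * (2 * sqrt (real m + 1)))\<^sup>2" by simp
  then have "1 \<le> cbin m * (2 * sqrt (real m + 1))"
    by (rule power2_le_imp_le) (simp add: cbin_pos less_imp_le)
  then show "cbin m \<ge> 1 / (2 * sqrt (real m + 1))"
    by (simp add: field_simps)
  have "(cbin m * sqrt (real m + 1))\<^sup>2 = (cbin m)\<^sup>2 * (real m + 1)"
    by (simp add: power_mult_distrib)
  also have "\<dots> \<le> (cbin m)\<^sup>2 * (2 * real m + 1)" by (intro mult_left_mono) auto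
  also have "\<dots> \<le> 1\<^sup>2" using 1 by simp
  finally have "cbin m * sqrt (real m + 1) \<le> 1"
    by (rule power2_le_imp_le) simp
  then show "cbin m \<le> 1 / sqrt (real m + 1)"
    by (simp add: field_simps)
qed

text \<open>
  \<open>cbin\<close> solves the linearised Catalan recursion exactly; the harmonic factor turns it
  into a supersolution with a gain of order \<open>1/m\<close> (\<open>hbin_gain\<close> below).
\<close>

definition hbin :: "nat \<Rightarrow> real" where
  "hbin m = cbin m * (1 + harm m)"

lemma hbin_0 [simp]: "hbin 0 = 1"
  by (simp add: hbin_def harm_def)

lemma hbin_pos: "hbin m > 0"
  by (simp add: hbin_def cbin_pos harm_nonneg add_pos_nonneg)

text \<open>The numerator \<open>i + 1\<close> counts the terms between the two harmonic numbers,
  each at least \<open>1 / (m + 1)\<close>. It is what turns \<open>scat i\<close> back into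
  \<open>cbin i\<close> in \<open>hbin_gain\<close>.\<close>

lemma harm_diff_ge:
  assumes "i \<le> m"
  shows "harm (Suc m) - harm (m - i) \<ge> (real i + 1) / (real m + 1)"
proof -
  have "harm (Suc m) = harm (m - i) + (\<Sum>k\<in>{m - i<..Suc m}. inverse (real k))"
  proof -
    have "{1..Suc m} = {1..m - i} \<union> {m - i<..Suc m}" using assms by auto
    then show ?thesis
      unfolding harm_def by (simp only:) (rule sum.union_disjoint, auto)
  qed
  moreover have "(\<Sum>k\<in>{m - i<..Suc m}. inverse (real k)) \<ge> (\<Sum>k\<in>{m - i<..Suc m}. inverse (real m + 1))"
    by (intro sum_mono le_imp_inverse_le) auto
  moreover have "(\<Sum>k\<in>{m - i<..Suc m}. inverse (real m + 1)) = (real i + 1) / (real m + 1)"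
    using assms by (simp add: divide_inverse Suc_diff_le)
  ultimately show ?thesis by simp
qed

text \<open>With the harmonic factor at \<open>m - i\<close> replaced by the one at
  \<open>Suc m\<close>, the recursion of \<open>cbin\<close> gives equality. The replacement raises
  the i-th term by at least \<open>cbin i * cbin (m - i) / (m + 1)\<close>, and these sum to
  \<open>1 / (m + 1)\<close>.\<close>

lemma hbin_gain: "4 * hbin (Suc m) - 2 * (\<Sum>i\<le>m. scat i * hbin (m - i)) \<ge> 2 / (real m + 1)"
proof -
  let ?S = "\<lambda>i. 1 + harm i :: real"
  have "(\<Sum>i\<le>m. cbin i * cbin (m - i) / (real m + 1)) \<le>
      (\<Sum>i\<le>m. scat i * cbin (m - i) * (?S (Suc m) - ?S (m - i)))"
  proof (intro sum_mono)
    fix i assume i: "i \<in> {..m}"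
    have "cbin i * cbin (m - i) / (real m + 1) =
        scat i * cbin (m - i) * ((real i + 1) / (real m + 1))"
      by (simp add: scat_def)
    also have "\<dots> \<le> scat i * cbin (m - i) * (?S (Suc m) - ?S (m - i))"
      using harm_diff_ge[of i m] i scat_pos[of i] cbin_pos[of "m - i"]
      by (intro mult_left_mono) auto
    finally show "cbin i * cbin (m - i) / (real m + 1) \<le>
      scat i * cbin (m - i) * (?S (Suc m) - ?S (m - i))" .
  qed
  also have "\<dots> = (\<Sum>i\<le>m. scat i * cbin (m - i) * ?S (Suc m)) - (\<Sum>i\<le>m. scat i * hbin (m - i))"
    by (simp only: right_diff_distrib sum_subtractf hbin_def mult.assoc)
  also have "(\<Sum>i\<le>m. scat i * cbin (m - i) * ?S (Suc m)) = 2 * hbin (Suc m)"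
    by (simp only: sum_distrib_right[symmetric] scat_cbin_convolution hbin_def)
  also have "(\<Sum>i\<le>m. cbin i * cbin (m - i) / (real m + 1)) = 1 / (real m + 1)"
    by (simp only: sum_divide_distrib[symmetric] cbin_convolution)
  finally show ?thesis by simp
qed


section \<open>The loop recursion\<close>

lemma abs_sum_mset_le:
  fixes f g :: "'a \<Rightarrow> real"
  assumes "\<And>x. x \<in># M \<Longrightarrow> \<bar>f x\<bar> \<le> g x"
  shows "\<bar>\<Sum>x\<in>#M. f x\<bar> \<le> (\<Sum>x\<in>#M. g x)"
  using assms
proof (induction M)
  case (add x M)
  then have "\<bar>f x\<bar> \<le> g x" "\<bar>\<Sum>x\<in>#M. f x\<bar> \<le> (\<Sum>x\<in>#M. g x)" by auto
  then show ?case by simp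
qed simp

lemma sum_mset_real_mult: "(\<Sum>l\<in>#L. real l * x) = real (\<Sum>\<^sub># L) * x"
  by (induction L) (auto simp: algebra_simps)

lemma prod_mset_pos:
  fixes f :: "'a \<Rightarrow> real"
  assumes "\<And>x. f x > 0"
  shows "(\<Prod>x\<in>#M. f x) > 0"
  by (induction M) (auto simp: assms)

lemma prod_mset_nonneg:
  fixes f :: "'a \<Rightarrow> real"
  assumes "\<And>x. f x \<ge> 0"
  shows "(\<Prod>x\<in>#M. f x) \<ge> 0"
  by (induction M) (auto simp: assms)

text \<open>The parameter \<alpha> stands for 2/\<beta>. Truncated subtraction is harmless:
  \<open>k - 1\<close> occurs with the factor \<open>real k\<close> or under \<open>a < k\<close>,
  and \<open>k + l - 1\<close> with the factor \<open>real l\<close>.\<close>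

locale loop_recursion =
  fixes T :: "nat multiset \<Rightarrow> real" and n \<alpha> :: real
  assumes n_pos: "n > 0" and alpha: "0 < \<alpha>" "\<alpha> \<le> 2"
    and T_empty: "T {#} = 1"
    and T_zero: "T (add_mset 0 L) = T L"
    and T_Suc: "4 * T (add_mset (Suc k) L) =
      (\<Sum>a<k. T (add_mset a (add_mset (k - 1 - a) L))) +
      (\<alpha> - 1) * real k / n * T (add_mset (k - 1) L) +
      \<alpha> / n\<^sup>2 * (\<Sum>l\<in>#L. real l * T (add_mset (k + l - 1) (L - {#l#})))"
begin

lemma odd_degree:
  assumes "odd (\<Sum>\<^sub># L)"
  shows "T L = 0"
  using assms
\<comment> \<open>Every term on the right of \<open>T_Suc\<close> with nonzero coefficient has
  degree lower by 2, so parity is kept. The size is added to the measure because removing a zero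
  block keeps the degree; splitting adds one block but still lowers the sum by 1.\<close>
proof (induction "\<Sum>\<^sub># L + size L" arbitrary: L rule: less_induct)
  case less
  show ?case
  proof (cases L)
    case empty
    then show ?thesis using less.prems by simp
  next
    case (add h L')
    show ?thesis
    proof (cases h)
      case 0
      then show ?thesis using less.hyps[of L'] less.prems add by (simp add: T_zero)
    next
      case (Suc k)
      have 1: "T (add_mset a (add_mset (k - 1 - a) L')) = 0" if "a < k" for a
        using that less.prems by (intro less.hyps) (auto simp: add Suc)
      have 2: "real k * T (add_mset (k - 1) L') = 0"
      proof (cases k)
        case (Suc j)
        then show ?thesis using less.prems \<open>h = Suc k\<close>
          by (intro mult_eq_0_iff[THEN iffD2] disjI2 less.hyps) (auto simp: add)
      qed simp
      have 3: "real l * T (add_mset (k + l - 1) (L' - {#l#})) = 0" if "l \<in># L'" for l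
      proof (cases l)
        case (Suc j)
        obtain L'' where "L' = add_mset l L''" using \<open>l \<in># L'\<close> by (metis insert_DiffM)
        then show ?thesis using less.prems \<open>h = Suc k\<close> Suc
          by (intro mult_eq_0_iff[THEN iffD2] disjI2 less.hyps) (auto simp: add)
      qed simp
      have 4: "(\<Sum>l\<in>#L'. real l * T (add_mset (k + l - 1) (L' - {#l#}))) = (\<Sum>l\<in>#L'. 0)"
        by (intro arg_cong[where f = sum_mset] image_mset_cong 3)
      have "4 * T L = 0"
        unfolding add Suc T_Suc 4 using 1 2 by simp
      then show ?thesis by simp
    qed
  qed
qed

text \<open>
  The gap to the leading order \<open>c\<close> satisfies the recursion with all coefficients replaced by
  their absolute values, so any supersolution of product form bounds it.
\<close>

lemma dominated:
  fixes c v R :: "nat \<Rightarrow> real" and N :: nat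
  assumes c_0: "c 0 = 1" and c_nonneg: "\<And>k. c k \<ge> 0"
    and c_Suc: "\<And>k. 4 * c (Suc k) = (\<Sum>a<k. c a * c (k - 1 - a))"
    and c_le_v: "\<And>k. c k \<le> v k" and v_pos: "\<And>k. v k > 0"
    and R_nonneg: "\<And>k. R k \<ge> 0"
    and R: "\<And>k l. l \<ge> 1 \<Longrightarrow> k + l < N \<Longrightarrow> v (k + l - 1) \<le> R k * v l"
    and v_Suc: "\<And>k. k < N \<Longrightarrow> (\<Sum>a<k. v a * v (k - 1 - a)) +
          real k / n * v (k - 1) + 2 / n\<^sup>2 * (real N * R k) \<le> 4 * v (Suc k)"
    and "\<Sum>\<^sub># L \<le> N"
  shows "\<bar>T L - (\<Prod>l\<in>#L. c l)\<bar> \<le> (\<Prod>l\<in>#L. v l) - (\<Prod>l\<in>#L. c l)"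
  using \<open>\<Sum>\<^sub># L \<le> N\<close>
proof (induction "\<Sum>\<^sub># L + size L" arbitrary: L rule: less_induct)
  case less
  let ?c = "\<lambda>L. \<Prod>l\<in>#L. c l" and ?v = "\<lambda>L. \<Prod>l\<in>#L. v l"
  note IH = less.hyps
  have c': "?c L \<ge> 0" for L by (intro prod_mset_nonneg c_nonneg)
  have v': "?v L > 0" for L by (intro prod_mset_pos v_pos)
  have IH': "\<bar>T M\<bar> \<le> ?v M" if "\<Sum>\<^sub># M + size M < \<Sum>\<^sub># L + size L" "\<Sum>\<^sub># M \<le> N" for M
    using IH[OF that] c'[of M] by linarith
  show ?case
  proof (cases L)
    case empty
    then show ?thesis by (simp add: T_empty)
  next
    case (add h L')
    show ?thesis
    proof (cases h)
      case 0
      have "\<bar>T L' - ?c L'\<bar> \<le> ?v L' - ?c L'"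
        using less.prems by (intro IH) (auto simp: add)
      \<comment> \<open>\<open>v 0\<close> may exceed 1, so a zero block only enlarges the
        bound.\<close>
      moreover have "1 * ?v L' \<le> v 0 * ?v L'"
        using c_le_v[of 0] c_0 v'[of L'] by (intro mult_right_mono) auto
      ultimately show ?thesis by (simp add: add 0 T_zero c_0)
    next
      case (Suc k)
      have kN: "k < N" using less.prems by (simp add: add Suc)
      define A where "A = (\<Sum>a<k. T (add_mset a (add_mset (k - 1 - a) L')))"
      define B where "B = (\<alpha> - 1) * real k / n * T (add_mset (k - 1) L')"
      define D where "D = (\<Sum>l\<in>#L'. real l * T (add_mset (k + l - 1) (L' - {#l#})))"
      have e: "(\<Sum>a<k. c a * c (k - 1 - a)) * ?c L' = 4 * ?c L"
        by (simp only: c_Suc[symmetric]) (simp add: add Suc)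
      \<comment> \<open>Products of \<open>c\<close> satisfy the splitting part of the recursion
        without error, so only \<open>A\<close> is compared with its leading order; \<open>B\<close>
        and \<open>D\<close> are estimated in absolute value.\<close>
      have "\<bar>A - (\<Sum>a<k. c a * c (k - 1 - a)) * ?c L'\<bar> \<le>
          (\<Sum>a<k. \<bar>T (add_mset a (add_mset (k - 1 - a) L')) - c a * c (k - 1 - a) * ?c L'\<bar>)"
        unfolding A_def sum_distrib_right sum_subtractf[symmetric] by (rule sum_abs)
      also have "\<dots> \<le> (\<Sum>a<k. v a * v (k - 1 - a) * ?v L' - c a * c (k - 1 - a) * ?c L')"
      proof (intro sum_mono)
        fix a assume "a \<in> {..<k}"
        then show "\<bar>T (add_mset a (add_mset (k - 1 - a) L')) - c a * c (k - 1 - a) * ?c L'\<bar>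
            \<le> v a * v (k - 1 - a) * ?v L' - c a * c (k - 1 - a) * ?c L'"
          using IH[of "add_mset a (add_mset (k - 1 - a) L')"] less.prems
          by (auto simp: add Suc mult_ac)
      qed
      also have "\<dots> = (\<Sum>a<k. v a * v (k - 1 - a)) * ?v L' - 4 * ?c L"
        by (simp only: sum_subtractf sum_distrib_right[symmetric] e)
      finally have 1: "\<bar>A - 4 * ?c L\<bar> \<le> (\<Sum>a<k. v a * v (k - 1 - a)) * ?v L' - 4 * ?c L"
        by (simp only: e)
      have 2: "\<bar>B\<bar> \<le> real k / n * v (k - 1) * ?v L'"
      proof (cases k)
        case (Suc j)
        have "\<bar>T (add_mset (k - 1) L')\<bar> \<le> v (k - 1) * ?v L'"
          using IH'[of "add_mset (k - 1) L'"] less.prems \<open>h = Suc k\<close> Suc by (auto simp: add)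
        moreover have "\<bar>(\<alpha> - 1) * real k / n\<bar> \<le> real k / n"
        proof -
          have "\<bar>\<alpha> - 1\<bar> * (real k / n) \<le> 1 * (real k / n)"
            using alpha n_pos by (intro mult_right_mono) auto
          then show ?thesis using n_pos by (simp add: abs_mult)
        qed
        ultimately have "\<bar>(\<alpha> - 1) * real k / n\<bar> * \<bar>T (add_mset (k - 1) L')\<bar> \<le>
            real k / n * (v (k - 1) * ?v L')"
          using n_pos by (intro mult_mono) auto
        then show ?thesis by (simp add: B_def abs_mult)
      qed (simp add: B_def)
      have "\<bar>D\<bar> \<le> (\<Sum>l\<in>#L'. real l * (R k * ?v L'))"
        unfolding D_def
      proof (intro abs_sum_mset_le)
        fix l assume l: "l \<in># L'"
        show "\<bar>real l * T (add_mset (k + l - 1) (L' - {#l#}))\<bar> \<le> real l * (R k * ?v L')"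
        proof (cases l)
          case (Suc j)
          obtain L'' where L'': "L' = add_mset l L''" using l by (metis insert_DiffM)
          have "\<bar>T (add_mset (k + l - 1) L'')\<bar> \<le> v (k + l - 1) * ?v L''"
            using IH'[of "add_mset (k + l - 1) L''"] less.prems \<open>h = Suc k\<close> Suc
            by (auto simp: add L'')
          also have "\<dots> \<le> R k * v l * ?v L''"
            using less.prems Suc v'[of L'']
            by (intro mult_right_mono R) (auto simp: add \<open>h = Suc k\<close> L'')
          finally have "\<bar>T (add_mset (k + l - 1) L'')\<bar> \<le> R k * ?v L'"
            by (simp add: L'' mult_ac)
          then show ?thesis by (simp add: L'' abs_mult mult_left_mono)
        qed simp
      qed
      \<comment> \<open>The cost \<open>R k\<close> of a merge does not depend on the partner
        \<open>l\<close>, so the weights \<open>l\<close> add up to the remaining degree. This makes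
        the condition on \<open>v\<close> independent of \<open>L'\<close>.\<close>
      also have "\<dots> = real (\<Sum>\<^sub># L') * (R k * ?v L')"
        by (rule sum_mset_real_mult)
      also have "\<dots> \<le> real N * (R k * ?v L')"
        using less.prems R_nonneg v'[of L']
        by (intro mult_right_mono of_nat_mono mult_nonneg_nonneg) (auto simp: add)
      finally have "\<alpha> / n\<^sup>2 * \<bar>D\<bar> \<le> 2 / n\<^sup>2 * (real N * (R k * ?v L'))"
        using alpha by (intro mult_mono divide_right_mono) auto
      then have 3: "\<bar>\<alpha> / n\<^sup>2 * D\<bar> \<le> 2 / n\<^sup>2 * (real N * R k) * ?v L'"
        using alpha by (simp add: abs_mult mult_ac)
      have 4: "4 * T L = A + B + \<alpha> / n\<^sup>2 * D"
        by (simp add: add Suc T_Suc A_def B_def D_def)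
      have "((\<Sum>a<k. v a * v (k - 1 - a)) + real k / n * v (k - 1) + 2 / n\<^sup>2 * (real N * R k)) * ?v L'
          \<le> 4 * v (Suc k) * ?v L'"
        using v'[of L'] by (intro mult_right_mono v_Suc kN) auto
      then have "(\<Sum>a<k. v a * v (k - 1 - a)) * ?v L' + real k / n * v (k - 1) * ?v L' +
          2 / n\<^sup>2 * (real N * R k) * ?v L' \<le> 4 * v (Suc k) * ?v L'"
        by (simp only: distrib_right)
      moreover have "4 * v (Suc k) * ?v L' = 4 * ?v L" by (simp add: add Suc)
      ultimately show ?thesis using 1 2 3 4 by linarith
    qed
  qed
qed


end

lemma sum_lessThan_double: "(\<Sum>a<2 * m. f a) = (\<Sum>i<m. f (2 * i) + f (2 * i + 1 :: nat))"
  for f :: "nat \<Rightarrow> 'a :: comm_monoid_add"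
  by (induction m) (simp_all add: add_ac)

context loop_recursion
begin

text \<open>On a singleton the bound of \<open>dominated\<close> is
  \<open>v (2 * j) - c (2 * j)\<close>, which is the even shift itself. \<open>\<Lambda>\<close>
  bounds \<open>hbin / cbin\<close> up to index \<open>N\<close>.\<close>

lemma even_moment:
  fixes N :: nat
  defines "\<Lambda> \<equiv> 1 + harm N :: real"
  assumes N: "N \<ge> 1" and large: "20 * (real N * sqrt (real N) * \<Lambda>\<^sup>2) \<le> n" and j: "2 * j \<le> N"
  shows "\<bar>T {#2 * j#} - scat j\<bar> \<le> 2 / n"
proof -
  \<comment> \<open>Odd moments only occur through correlations between two odd blocks. The size \<open>\<eta>\<close> is the
    smallest for which merging two odd blocks is absorbed by the gain of \<open>hbin\<close>;
    \<open>R\<close> bounds the cost of merging a block of size \<open>k\<close> into any other block.\<close>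
  define \<eta> where "\<eta> = sqrt (8 * real N) / n"
  define c where "c k = (if even k then scat (k div 2) else 0)" for k :: nat
  define v where "v k = (if even k then scat (k div 2) + 2 / n else \<eta> * hbin (k div 2))" for k :: nat
  define R where "R k = (if k = 0 then 3 * \<eta> * \<Lambda> * N + 2 / \<eta> else if odd k then \<Lambda>
      else 2 * \<eta> * \<Lambda> * N + 4 / (\<eta> * (real k / 2)))" for k :: nat
  have \<eta>_pos: "\<eta> > 0" using N n_pos by (simp add: \<eta>_def)
  have \<eta>_sq: "\<eta>\<^sup>2 = 8 * real N / n\<^sup>2" by (simp add: \<eta>_def power_divide)
  have \<Lambda>: "\<Lambda> \<ge> 1" by (simp add: \<Lambda>_def harm_nonneg)
  have \<Lambda>_sq: "\<Lambda> \<le> \<Lambda>\<^sup>2" using \<Lambda> by (simp add: power2_eq_square)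
  have sqrtN: "1 \<le> sqrt N" "sqrt N \<le> N" 
    using N by (auto simp: real_le_lsqrt power2_eq_square intro!: real_le_lsqrt)
  have N1: "real N \<ge> 1" using N by simp
  \<comment> \<open>Weaker forms of \<open>large\<close>. The bounds \<open>l4\<close> and
    \<open>l5\<close> serve the part of \<open>R\<close> proportional to
    \<open>\<eta> * \<Lambda> * N\<close>, whose cost relative to \<eta> is of second order in
    1/n.\<close>
  have l1: "20 * (real N * sqrt N * \<Lambda>) \<le> n"
    using \<Lambda>_sq large mult_left_mono[OF \<Lambda>_sq, of "real N * sqrt N"] by simp
  have l2: "20 * (real N * sqrt N) \<le> n"
    using l1 mult_left_mono[OF \<Lambda>, of "real N * sqrt N"] by simp
  have l3: "20 * real N \<le> n"
    using l2 mult_left_mono[OF sqrtN(1), of "real N"] by simp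
  have l4: "400 * (\<Lambda> * real N ^ 3) \<le> n\<^sup>2"
  proof -
    have "\<Lambda> * real N ^ 3 \<le> \<Lambda>\<^sup>2 * real N ^ 3" using \<Lambda>_sq by (intro mult_right_mono) auto
    also have "\<dots> = (real N * sqrt N * \<Lambda>)\<^sup>2"
      by (simp add: power_mult_distrib power3_eq_cube power2_eq_square)
    finally have "400 * (\<Lambda> * real N ^ 3) \<le> (20 * (real N * sqrt N * \<Lambda>))\<^sup>2"
      by (simp add: power_mult_distrib)
    also have "\<dots> \<le> n\<^sup>2" using l1 \<Lambda> by (intro power_mono) auto
    finally show ?thesis .
  qed
  have l5: "400 * (\<Lambda> * real N ^ 2) \<le> n\<^sup>2"
  proof -
    have "\<Lambda> * real N ^ 2 * 1 \<le> \<Lambda> * real N ^ 2 * N" using N1 \<Lambda> by (intro mult_left_mono) auto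
    then show ?thesis using l4 by (simp add: power3_eq_cube power2_eq_square)
  qed
  have hbin_le: "hbin i \<le> \<Lambda> * cbin i" if "i \<le> N" for i
    using harm_mono[OF that, where 'a = real] cbin_pos[of i] by (simp add: hbin_def \<Lambda>_def mult.commute mult_right_mono)
  have cbin_le_hbin: "cbin i \<le> hbin i" for i
    using cbin_pos[of i] by (simp add: hbin_def harm_nonneg algebra_simps)
  have cbin_anti: "cbin i \<le> cbin j" if "j \<le> i" for i j
    using that by (induction rule: dec_induct) (use cbin_Suc_le order_trans in blast)+
  have scat_anti: "scat i \<le> scat j" if "j \<le> i" for i j
    using that cbin_anti[OF that] cbin_pos[of i] unfolding scat_def by (intro frac_le) (auto simp: less_imp_le)
  have cbin_ge: "cbin q \<ge> 1 / (2 * sqrt N)" if "q + 1 \<le> N" for q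
  proof -
    have "1 / (2 * sqrt N) \<le> 1 / (2 * sqrt (real q + 1))"
      using that N by (intro divide_left_mono mult_left_mono real_sqrt_le_mono) auto
    then show ?thesis using cbin_lower[of q] by linarith
  qed
  \<comment> \<open>Lets the even shift be absorbed when an even entry of \<open>v\<close> is
    compared with \<open>hbin\<close>, the profile of the odd entries.\<close>
  have inv_n_le: "2 / n \<le> cbin q / (real m + 1)" if "q + 1 \<le> N" "m + 1 \<le> N" for q m
  proof -
    have "(real m + 1) * (4 * sqrt N) \<le> real N * (4 * sqrt N)"
      using that by (intro mult_right_mono) auto
    also have "\<dots> = 4 * (real N * sqrt N)" by simp
    also have "\<dots> \<le> 20 * (real N * sqrt N)" by simp
    also note l2
    finally have "2 / n \<le> (1 / (2 * sqrt N)) / (real m + 1)"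
      using N n_pos by (simp add: divide_simps mult_ac)
    also have "\<dots> \<le> cbin q / (real m + 1)"
      using cbin_ge[OF that(1)] by (intro divide_right_mono) auto
    finally show ?thesis .
  qed
  have cbin_eq: "cbin q = (real q + 1) * scat q" for q by (simp add: scat_def add_eq_0_iff_both_eq_0)
  have cbin_le_scat: "cbin q \<le> N * scat q" if "q + 1 \<le> N" for q
    unfolding cbin_eq using that scat_pos[of q] by (intro mult_right_mono) auto
  have "\<bar>T {#2 * j#} - (\<Prod>l\<in>#{#2 * j#}. c l)\<bar> \<le> (\<Prod>l\<in>#{#2 * j#}. v l) - (\<Prod>l\<in>#{#2 * j#}. c l)"
  proof (rule dominated[where R = R and N = N])
    show "c 0 = 1" by (simp add: c_def)
    show "c k \<ge> 0" for k by (simp add: c_def scat_pos less_imp_le)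
    show "c k \<le> v k" for k using hbin_pos[of "k div 2"] n_pos \<eta>_pos by (simp add: c_def v_def)
    show "v k > 0" for k using hbin_pos[of "k div 2"] scat_pos[of "k div 2"] n_pos \<eta>_pos
      by (simp add: v_def add_pos_pos)
    show "R k \<ge> 0" for k using \<eta>_pos \<Lambda> by (simp add: R_def)
    show "\<Sum>\<^sub># {#2 * j#} \<le> N" using j by simp
    show "4 * c (Suc k) = (\<Sum>a<k. c a * c (k - 1 - a))" for k
    proof (cases "even k")
      case True
      then have "(\<Sum>a<k. c a * c (k - 1 - a)) = 0"
        by (intro sum.neutral) (auto simp: c_def)
      then show ?thesis using True by (simp add: c_def)
    next
      case False
      then obtain m where k: "k = 2 * m + 1" by (elim oddE)
      have "(\<Sum>a<k. c a * c (k - 1 - a)) = (\<Sum>i<m. scat i * scat (m - i)) + scat m * scat 0"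
        by (simp add: k sum_lessThan_double c_def diff_mult_distrib2[symmetric])
      also have "\<dots> = 4 * scat (Suc m)"
        by (simp add: scat_convolution[symmetric] lessThan_Suc_atMost[symmetric])
      finally show ?thesis by (simp add: k c_def)
    qed
    \<comment> \<open>Merging sends \<open>l\<close> to \<open>k + l - 1\<close>: odd
      \<open>k\<close> keeps the parity of \<open>l\<close>, and the ratio is at most
      \<open>\<Lambda>\<close>. Even \<open>k\<close> flips it: the two summands of
      \<open>R k\<close> treat even \<open>l\<close> (large to small) and odd \<open>l\<close>
      (small to large, hence the 1 / \<eta>).\<close>
    show "v (k + l - 1) \<le> R k * v l" if l: "l \<ge> 1" "k + l < N" for k l
    proof (cases "k = 0")
      case k: True
      define q where "q = l div 2"
      show ?thesis
      proof (cases "even l")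
        case True
        then obtain q' where q': "l = 2 * Suc q'" using l(1) by (metis dvdE mult_0_right not_one_le_zero not0_implies_Suc)
        have "hbin q' \<le> \<Lambda> * cbin q'" using l q' by (intro hbin_le) auto
        also have "\<dots> \<le> \<Lambda> * (2 * (N * scat (Suc q')))"
          using \<Lambda> l q' cbin_le_double[of q'] cbin_le_scat[of "Suc q'"] by (intro mult_left_mono) auto
        finally have "\<eta> * hbin q' \<le> \<eta> * (\<Lambda> * (2 * (N * scat (Suc q'))))"
          using \<eta>_pos by (intro mult_left_mono) auto
        also have "\<dots> = 2 * \<eta> * \<Lambda> * N * scat (Suc q')" by simp
        also have "\<dots> \<le> R 0 * (scat (Suc q') + 2 / n)"
          using \<eta>_pos \<Lambda> scat_pos[of "Suc q'"] n_pos unfolding R_def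
          by (intro mult_mono) auto
        finally show ?thesis by (simp add: v_def k q')
      next
        case False
        then have l': "l = 2 * q + 1" by (simp add: q_def)
        have "scat q \<le> cbin q" using cbin_pos[of q] by (simp add: scat_def divide_simps)
        moreover have "2 / n \<le> cbin q" using inv_n_le[of q 0] l l' by simp
        ultimately have "scat q + 2 / n \<le> 2 / \<eta> * (\<eta> * hbin q)"
          using cbin_le_hbin[of q] \<eta>_pos by simp
        also have "\<dots> \<le> R 0 * (\<eta> * hbin q)"
          using \<eta>_pos \<Lambda> hbin_pos[of q] unfolding R_def by (intro mult_right_mono) auto
        finally show ?thesis by (simp add: v_def k l')
      qed
    next
      case k0: False
      show ?thesis
      proof (cases "odd k")
        case True
        then obtain m where k: "k = 2 * m + 1" by (elim oddE)
        define q where "q = l div 2"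
        show ?thesis
        proof (cases "even l")
          case True
          then have l': "l = 2 * q" by (simp add: q_def)
          have "scat (m + q) + 2 / n \<le> 1 * (scat q + 2 / n)" using scat_anti[of q "m + q"] by simp
          also have "\<dots> \<le> \<Lambda> * (scat q + 2 / n)"
            using \<Lambda> scat_pos[of q] n_pos by (intro mult_right_mono) auto
          finally show ?thesis by (simp add: v_def R_def k l')
        next
          case False
          then have l': "l = 2 * q + 1" by (simp add: q_def)
          have "hbin (m + q) \<le> \<Lambda> * cbin (m + q)" using l k l' by (intro hbin_le) auto
          also have "\<dots> \<le> \<Lambda> * hbin q"
            using \<Lambda> cbin_anti[of q "m + q"] cbin_le_hbin[of q] by (intro mult_left_mono) auto
          finally have "\<eta> * hbin (m + q) \<le> \<eta> * (\<Lambda> * hbin q)"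
            using \<eta>_pos by (intro mult_left_mono) auto
          then show ?thesis by (simp add: v_def R_def k l' mult_ac)
        qed
      next
        case False
        then obtain m where k: "k = 2 * Suc m" using k0 by (metis evenE mult_0_right not0_implies_Suc)
        define q where "q = l div 2"
        show ?thesis
        proof (cases "even l")
          case True
          then have l': "l = 2 * q" by (simp add: q_def)
          have e: "k + l - 1 = 2 * (m + q) + 1" by (simp add: k l')
          have "hbin (m + q) \<le> \<Lambda> * cbin (m + q)" using l k l' by (intro hbin_le) auto
          also have "\<dots> \<le> \<Lambda> * (N * scat q)"
            using \<Lambda> l l' k cbin_anti[of q "m + q"] cbin_le_scat[of q] by (intro mult_left_mono) auto
          finally have "\<eta> * hbin (m + q) \<le> \<eta> * (\<Lambda> * (N * scat q))"
            using \<eta>_pos by (intro mult_left_mono) auto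
          also have "\<dots> = \<eta> * \<Lambda> * N * scat q" by simp
          also have "\<dots> \<le> R k * (scat q + 2 / n)"
            using \<eta>_pos \<Lambda> scat_pos[of q] n_pos unfolding R_def k
            by (intro mult_mono) (auto simp: add_increasing2)
          finally show ?thesis unfolding e by (simp add: v_def l')
        next
          case False
          then have l': "l = 2 * q + 1" by (simp add: q_def)
          have e: "k + l - 1 = 2 * (m + q + 1)" by (simp add: k l')
          have "scat (m + q + 1) \<le> cbin q / (real m + 1)"
            unfolding scat_def using cbin_anti[of q "m + q + 1"] cbin_pos[of q] by (intro frac_le) auto
          moreover have "2 / n \<le> cbin q / (real m + 1)" using inv_n_le[of q m] l l' k by simp
          ultimately have "scat (m + q + 1) + 2 / n \<le> 2 * (cbin q / (real m + 1))" by simp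
          also have "\<dots> \<le> 4 * (hbin q / (real m + 1))"
            using cbin_le_hbin[of q] cbin_pos[of q] hbin_pos[of q] by (intro mult_mono divide_right_mono) auto
          also have "\<dots> = 4 / (\<eta> * (real k / 2)) * (\<eta> * hbin q)"
            using \<eta>_pos by (simp add: k divide_simps)
          also have "\<dots> \<le> R k * (\<eta> * hbin q)"
            using \<eta>_pos \<Lambda> hbin_pos[of q] unfolding R_def k by (intro mult_right_mono) auto
          finally show ?thesis unfolding e by (simp add: v_def l')
        qed
      qed
    qed
    show "(\<Sum>a<k. v a * v (k - 1 - a)) + real k / n * v (k - 1) + 2 / n\<^sup>2 * (real N * R k) \<le> 4 * v (Suc k)"
      if kN: "k < N" for k
    proof (cases "k = 0")
      case True
      have l: "6 * \<eta> * (\<Lambda> * real N ^ 2 / n\<^sup>2) \<le> 6 * \<eta> * (1 / 400)"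
        using l5 n_pos \<eta>_pos by (intro mult_left_mono) (auto simp: field_simps)
      \<comment> \<open>Available is \<open>4 * v 1 = 4 * \<eta>\<close>; by the choice of \<eta>
        the singular part of \<open>R 0\<close> takes only an eighth of it.\<close>
      have "2 / n\<^sup>2 * (real N * (2 / \<eta>)) = \<eta> / 2"
      proof -
        have "2 / n\<^sup>2 * (real N * (2 / \<eta>)) = 8 * real N / n\<^sup>2 / (2 * \<eta>)" by simp
        also have "\<dots> = \<eta>\<^sup>2 / (2 * \<eta>)" by (simp only: \<eta>_sq)
        also have "\<dots> = \<eta> / 2" using \<eta>_pos by (simp add: power2_eq_square)
        finally show ?thesis .
      qed
      moreover have "2 / n\<^sup>2 * (real N * (3 * \<eta> * \<Lambda> * N)) = 6 * \<eta> * (\<Lambda> * real N ^ 2 / n\<^sup>2)"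
        by (simp add: power2_eq_square)
      moreover have "2 / n\<^sup>2 * (real N * R k) =
          2 / n\<^sup>2 * (real N * (3 * \<eta> * \<Lambda> * N)) + 2 / n\<^sup>2 * (real N * (2 / \<eta>))"
        unfolding True R_def by (simp only: simp_thms if_True distrib_left)
      moreover have "(\<Sum>a<k. v a * v (k - 1 - a)) + real k / n * v (k - 1) = 0" using True by simp
      ultimately have "(\<Sum>a<k. v a * v (k - 1 - a)) + real k / n * v (k - 1) + 2 / n\<^sup>2 * (real N * R k) =
          6 * \<eta> * (\<Lambda> * real N ^ 2 / n\<^sup>2) + \<eta> / 2"
        by (simp only: add_0_left)
      also have "\<dots> \<le> 6 * \<eta> * (1 / 400) + \<eta> / 2" using l by (intro add_right_mono)
      also have "\<dots> \<le> 4 * v (Suc k)" using True \<eta>_pos by (simp add: v_def)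
      finally show ?thesis .
    next
      case k0: False
      show ?thesis
      proof (cases "odd k")
        case True
        then obtain m where k: "k = 2 * m + 1" by (elim oddE)
        define \<rho> where "\<rho> = 2 / n"
        have "(\<Sum>a<k. v a * v (k - 1 - a)) =
            (\<Sum>i\<le>m. (scat i + \<rho>) * (scat (m - i) + \<rho>)) + (\<Sum>i<m. (\<eta> * hbin i) * (\<eta> * hbin (m - 1 - i)))"
        proof -
          have "(\<Sum>a<k. v a * v (k - 1 - a)) =
              (\<Sum>i<m. v (2 * i) * v (k - 1 - 2 * i) + v (2 * i + 1) * v (k - 1 - (2 * i + 1))) + v (2 * m) * v 0"
            by (simp add: k sum_lessThan_double)
          also have "(\<Sum>i<m. v (2 * i) * v (k - 1 - 2 * i) + v (2 * i + 1) * v (k - 1 - (2 * i + 1))) =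
              (\<Sum>i<m. (scat i + \<rho>) * (scat (m - i) + \<rho>) + (\<eta> * hbin i) * (\<eta> * hbin (m - 1 - i)))"
          proof (intro sum.cong refl)
            fix i assume "i \<in> {..<m}"
            then have "k - 1 - 2 * i = 2 * (m - i)" "k - 1 - (2 * i + 1) = 2 * (m - 1 - i) + 1"
              by (auto simp: k)
            then show "v (2 * i) * v (k - 1 - 2 * i) + v (2 * i + 1) * v (k - 1 - (2 * i + 1)) =
                (scat i + \<rho>) * (scat (m - i) + \<rho>) + (\<eta> * hbin i) * (\<eta> * hbin (m - 1 - i))"
              by (simp only:) (simp add: v_def \<rho>_def)
          qed
          finally show ?thesis
            by (simp add: sum.distrib lessThan_Suc_atMost[symmetric] v_def \<rho>_def)
        qed
        also have "(\<Sum>i\<le>m. (scat i + \<rho>) * (scat (m - i) + \<rho>)) =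
            (\<Sum>i\<le>m. scat i * scat (m - i)) + \<rho> * (\<Sum>i\<le>m. scat i) + \<rho> * (\<Sum>i\<le>m. scat (m - i)) + \<rho>\<^sup>2 * (real m + 1)"
          by (simp add: algebra_simps sum.distrib sum_distrib_left power2_eq_square)
        \<comment> \<open>Against \<open>4 * v (Suc k) = 4 * scat (Suc m) + 4 * \<rho>\<close> this
          leaves a slack of \<open>4 * \<rho> * cbin (Suc m) = 8 * cbin (Suc m) / n\<close>, to be
          spent in two halves.\<close>
        also have "\<dots> = 4 * scat (Suc m) + 2 * \<rho> * (2 - 2 * cbin (Suc m)) + \<rho>\<^sup>2 * (real m + 1)"
          using sum_rev_le[of "\<lambda>i j. scat i" m] by (simp add: scat_convolution sum_scat)
        finally have 1: "(\<Sum>a<k. v a * v (k - 1 - a)) = 4 * scat (Suc m) + 2 * \<rho> * (2 - 2 * cbin (Suc m)) + \<rho>\<^sup>2 * (real m + 1)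
           + (\<Sum>i<m. (\<eta> * hbin i) * (\<eta> * hbin (m - 1 - i)))" .
        have "(\<Sum>i<m. (\<eta> * hbin i) * (\<eta> * hbin (m - 1 - i))) \<le>
            (\<Sum>i<m. (\<eta> * (\<Lambda> * cbin i)) * (\<eta> * (\<Lambda> * cbin (m - 1 - i))))"
          using \<eta>_pos \<Lambda> kN k hbin_pos cbin_pos
          by (intro sum_mono mult_mono hbin_le) (auto intro!: mult_nonneg_nonneg less_imp_le)
        also have "\<dots> = \<eta>\<^sup>2 * \<Lambda>\<^sup>2 * (\<Sum>i<m. cbin i * cbin (m - 1 - i))"
          by (simp add: sum_distrib_left power2_eq_square mult_ac)
        also have "\<dots> \<le> \<eta>\<^sup>2 * \<Lambda>\<^sup>2 * 1"
        proof (intro mult_left_mono)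
          show "(\<Sum>i<m. cbin i * cbin (m - 1 - i)) \<le> 1"
          proof (cases m)
            case (Suc m')
            then show ?thesis using cbin_convolution[of m'] by (simp add: lessThan_Suc_atMost)
          qed simp
        qed auto
        finally have 2: "(\<Sum>i<m. (\<eta> * hbin i) * (\<eta> * hbin (m - 1 - i))) \<le> 8 * real N / n\<^sup>2 * \<Lambda>\<^sup>2"
          by (simp add: \<eta>_sq)
        \<comment> \<open>The first half of the slack pays for the term with coefficient
          \<open>k / n\<close>, up to a remainder of order k / n^2.\<close>
        have "real k * scat m \<le> 2 * cbin m"
          using scat_pos[of m] unfolding cbin_eq k by simp
        also have "\<dots> \<le> 4 * cbin (Suc m)" using cbin_le_double[of m] by simp
        finally have "real k * scat m / n \<le> 4 * cbin (Suc m) / n"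
          using n_pos by (intro divide_right_mono) auto
        then have 3: "real k / n * v (k - 1) \<le> 4 * cbin (Suc m) / n + 2 * real k / n\<^sup>2"
          by (simp add: v_def k distrib_left power2_eq_square)
        \<comment> \<open>The second half pays for everything of order 1 / n^2. The largest
          contribution, from products of two odd entries, carries \<open>\<Lambda>\<^sup>2\<close>,
          and here \<open>large\<close> is used in full strength, together with the lower bound on
          \<open>cbin\<close>.\<close>
        have "4 * (real m + 1) + 8 * real N * \<Lambda>\<^sup>2 + 2 * real k + 2 * real N * \<Lambda> \<le> 14 * (real N * \<Lambda>\<^sup>2)"
        proof -
          have "real N \<le> real N * \<Lambda>\<^sup>2" "real N * \<Lambda> \<le> real N * \<Lambda>\<^sup>2"
            using \<Lambda> \<Lambda>_sq by (auto intro!: mult_left_mono simp: mult_le_cancel_left1)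
          moreover have "4 * (real m + 1) + 2 * real k \<le> 4 * real N" using kN k by simp
          ultimately show ?thesis by linarith
        qed
        also have "\<dots> \<le> 20 * (real N * \<Lambda>\<^sup>2)" by simp
        also have "\<dots> \<le> n / sqrt N"
          using large N by (simp add: field_simps)
        also have "\<dots> = 2 * (1 / (2 * sqrt N)) * n" by simp
        also have "\<dots> \<le> 2 * cbin (Suc m) * n"
          using kN k n_pos by (intro mult_right_mono mult_left_mono cbin_ge) auto
        also have "\<dots> \<le> 4 * cbin (Suc m) * n" using n_pos cbin_pos[of "Suc m"] by simp
        finally have "(4 * (real m + 1) + 8 * real N * \<Lambda>\<^sup>2 + 2 * real k + 2 * real N * \<Lambda>) / n\<^sup>2 \<le> (4 * cbin (Suc m) * n) / n\<^sup>2"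
          by (intro divide_right_mono) auto
        then have 4: "4 * (real m + 1) / n\<^sup>2 + 8 * real N / n\<^sup>2 * \<Lambda>\<^sup>2 + 2 * real k / n\<^sup>2 + 2 / n\<^sup>2 * (real N * \<Lambda>)
            \<le> 4 * cbin (Suc m) / n"
          using n_pos by (simp add: add_divide_distrib power2_eq_square mult.assoc)
        have 5: "2 * \<rho> * (2 - 2 * cbin (Suc m)) = 8 / n - 8 * cbin (Suc m) / n"
          by (simp add: \<rho>_def algebra_simps)
        have 6: "\<rho>\<^sup>2 * (real m + 1) = 4 * (real m + 1) / n\<^sup>2" by (simp add: \<rho>_def power_divide)
        have 7: "4 * v (Suc k) = 4 * scat (Suc m) + 8 / n" by (simp add: v_def k)
        have 8: "2 / n\<^sup>2 * (real N * R k) = 2 / n\<^sup>2 * (real N * \<Lambda>)" by (simp add: R_def k)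
        show ?thesis using 1 2 3 4 unfolding 5 6 7 8 by linarith
      next
        case False
        then obtain m where k: "k = 2 * Suc m" using k0 by (metis evenE mult_0_right not0_implies_Suc)
        define r where "r = sqrt (real m + 1)"
        have r: "r > 0" "r * r = real m + 1" by (simp_all add: r_def)
        have "(\<Sum>a<k. v a * v (k - 1 - a)) = 2 * (\<Sum>i\<le>m. (scat i + 2 / n) * (\<eta> * hbin (m - i)))"
        proof -
          have "(\<Sum>a<k. v a * v (k - 1 - a)) =
              (\<Sum>i<Suc m. v (2 * i) * v (k - 1 - 2 * i) + v (2 * i + 1) * v (k - 1 - (2 * i + 1)))"
            unfolding k by (rule sum_lessThan_double)
          also have "\<dots> = (\<Sum>i\<le>m. (scat i + 2 / n) * (\<eta> * hbin (m - i)) + (scat (m - i) + 2 / n) * (\<eta> * hbin i))"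
            unfolding lessThan_Suc_atMost
          proof (intro sum.cong refl)
            fix i assume "i \<in> {..m}"
            then have "k - 1 - 2 * i = 2 * (m - i) + 1" "k - 1 - (2 * i + 1) = 2 * (m - i)"
              by (auto simp: k)
            then show "v (2 * i) * v (k - 1 - 2 * i) + v (2 * i + 1) * v (k - 1 - (2 * i + 1)) =
                (scat i + 2 / n) * (\<eta> * hbin (m - i)) + (scat (m - i) + 2 / n) * (\<eta> * hbin i)"
              by (simp only:) (simp add: v_def)
          qed
          also have "\<dots> = 2 * (\<Sum>i\<le>m. (scat i + 2 / n) * (\<eta> * hbin (m - i)))"
            unfolding sum.distrib using sum_rev_le[of "\<lambda>i j. (scat i + 2 / n) * (\<eta> * hbin j)" m] by simp
          finally show ?thesis .
        qed
        also have "\<dots> = \<eta> * (2 * (\<Sum>i\<le>m. scat i * hbin (m - i))) + 4 * \<eta> / n * (\<Sum>i\<le>m. hbin (m - i))"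
          by (simp add: algebra_simps sum.distrib sum_distrib_left sum_divide_distrib)
        also have "(\<Sum>i\<le>m. hbin (m - i)) = (\<Sum>i\<le>m. hbin i)"
          using sum_rev_le[of "\<lambda>i j. hbin i" m] by simp
        finally have 1: "(\<Sum>a<k. v a * v (k - 1 - a)) =
           \<eta> * (2 * (\<Sum>i\<le>m. scat i * hbin (m - i))) + 4 * \<eta> / n * (\<Sum>i\<le>m. hbin i)" .
        \<comment> \<open>The gain \<open>2 * \<eta> / (m + 1)\<close> is again split in halves: one
          for merging with odd blocks, one for all the other terms.\<close>
        have 2: "\<eta> * (2 * (\<Sum>i\<le>m. scat i * hbin (m - i))) \<le> \<eta> * (4 * hbin (Suc m) - 2 / (real m + 1))"
          using hbin_gain[of m] \<eta>_pos by (intro mult_left_mono) auto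
        have b: "cbin m \<le> 1 / r" using cbin_upper[of m] by (simp add: r_def)
        have "(\<Sum>i\<le>m. hbin i) \<le> (\<Sum>i\<le>m. \<Lambda> * cbin i)"
          using kN k by (intro sum_mono hbin_le) auto
        also have "\<dots> = \<Lambda> * ((2 * real m + 1) * cbin m)"
          by (simp add: sum_distrib_left[symmetric] sum_cbin)
        also have "\<dots> \<le> \<Lambda> * ((2 * (r * r)) * (1 / r))"
          using \<Lambda> b cbin_pos[of m] by (intro mult_left_mono mult_mono) (auto simp: r(2))
        also have "\<dots> = 2 * \<Lambda> * r" using r(1) by simp
        finally have "(\<Sum>i\<le>m. hbin i) \<le> 2 * \<Lambda> * r" .
        then have 3: "4 * \<eta> / n * (\<Sum>i\<le>m. hbin i) \<le> \<eta> * (8 * \<Lambda> * r / n)"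
          using \<eta>_pos n_pos mult_left_mono[of "\<Sum>i\<le>m. hbin i" "2 * \<Lambda> * r" "4 * \<eta> / n"] by (simp add: mult_ac)
        have "hbin m \<le> \<Lambda> * cbin m" using kN k by (intro hbin_le) auto
        also have "\<dots> \<le> \<Lambda> * (1 / r)" using \<Lambda> b by (intro mult_left_mono) auto
        finally have "real k / n * (\<eta> * hbin m) \<le> (2 * (r * r)) / n * (\<eta> * (\<Lambda> * (1 / r)))"
          using \<eta>_pos n_pos r by (intro mult_mono divide_right_mono) (auto simp: k hbin_pos less_imp_le)
        also have "\<dots> = \<eta> * (2 * \<Lambda> * r / n)" using r(1) by (simp add: mult_ac)
        finally have 4: "real k / n * v (k - 1) \<le> \<eta> * (2 * \<Lambda> * r / n)" by (simp add: v_def k)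
        have "real k / 2 = real m + 1" by (simp add: k)
        \<comment> \<open>Exactly the first half, because
          \<open>\<eta>\<^sup>2 = 8 * N / n\<^sup>2\<close>.\<close>
        then have "2 / n\<^sup>2 * (real N * (4 / (\<eta> * (real k / 2)))) = 8 * real N / n\<^sup>2 / (\<eta> * (real m + 1))"
          by (simp only:) simp
        also have "\<dots> = \<eta>\<^sup>2 / (\<eta> * (real m + 1))" by (simp only: \<eta>_sq)
        also have "\<dots> = \<eta> * (1 / (real m + 1))" using \<eta>_pos by (simp add: power2_eq_square)
        finally have a: "2 / n\<^sup>2 * (real N * (4 / (\<eta> * (real k / 2)))) = \<eta> * (1 / (real m + 1))" .
        have 5: "2 / n\<^sup>2 * (real N * R k) = \<eta> * (1 / (real m + 1)) + \<eta> * (4 * \<Lambda> * real N ^ 2 / n\<^sup>2)"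
        proof -
          have "R k = 2 * \<eta> * \<Lambda> * N + 4 / (\<eta> * (real k / 2))" by (simp add: R_def k)
          then have "2 / n\<^sup>2 * (real N * R k) = 2 / n\<^sup>2 * (real N * (2 * \<eta> * \<Lambda> * N)) + \<eta> * (1 / (real m + 1))"
            by (simp only: distrib_left a)
          moreover have "2 / n\<^sup>2 * (real N * (2 * \<eta> * \<Lambda> * N)) = \<eta> * (4 * \<Lambda> * real N ^ 2 / n\<^sup>2)"
            by (simp add: power2_eq_square)
          ultimately show ?thesis by linarith
        qed
        \<comment> \<open>The second half covers, divided by \<eta>, the even shift in the
          convolution, the term with coefficient \<open>k / n\<close>, and the regular part of
          \<open>R k\<close>.\<close>
        have 6: "8 * \<Lambda> * r / n + 2 * \<Lambda> * r / n + 4 * \<Lambda> * real N ^ 2 / n\<^sup>2 \<le> 1 / (real m + 1)"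
        proof -
          have mN: "real m + 1 \<le> N" using kN k by simp
          have "(real m + 1) * r * \<Lambda> \<le> real N * sqrt N * \<Lambda>"
            unfolding r_def using mN \<Lambda> by (intro mult_mono real_sqrt_le_mono) auto
          then have A: "(real m + 1) * (10 * \<Lambda> * r / n) \<le> 1 / 2"
            using l1 n_pos by (simp add: field_simps)
          have "(real m + 1) * (\<Lambda> * real N ^ 2) \<le> real N * (\<Lambda> * real N ^ 2)"
            using mN \<Lambda> by (intro mult_right_mono) auto
          also have "\<dots> = \<Lambda> * real N ^ 3" by (simp add: power3_eq_cube power2_eq_square)
          finally have C: "(real m + 1) * (\<Lambda> * real N ^ 2) \<le> \<Lambda> * real N ^ 3" .
          have "8 * ((real m + 1) * (\<Lambda> * real N ^ 2)) \<le> 400 * (\<Lambda> * real N ^ 3)"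
            by (intro mult_mono C) (use \<Lambda> in auto)
          also note l4
          finally have B: "(real m + 1) * (4 * \<Lambda> * real N ^ 2 / n\<^sup>2) \<le> 1 / 2"
            using n_pos by (simp add: field_simps)
          have "(real m + 1) * (8 * \<Lambda> * r / n + 2 * \<Lambda> * r / n + 4 * \<Lambda> * real N ^ 2 / n\<^sup>2) =
            (real m + 1) * (10 * \<Lambda> * r / n) + (real m + 1) * (4 * \<Lambda> * real N ^ 2 / n\<^sup>2)"
            by (simp add: distrib_left add_divide_distrib[symmetric])
          then have "(real m + 1) * (8 * \<Lambda> * r / n + 2 * \<Lambda> * r / n + 4 * \<Lambda> * real N ^ 2 / n\<^sup>2) \<le> 1"
            using A B by linarith
          then show ?thesis by (simp add: pos_le_divide_eq mult.commute)
        qed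
        have 7: "\<eta> * (8 * \<Lambda> * r / n + 2 * \<Lambda> * r / n + 4 * \<Lambda> * real N ^ 2 / n\<^sup>2) \<le> \<eta> * (1 / (real m + 1))"
          using \<eta>_pos by (intro mult_left_mono 6) auto
        have 8: "4 * v (Suc k) = \<eta> * (4 * hbin (Suc m))" by (simp add: v_def k)
        have 9: "\<eta> * (4 * hbin (Suc m) - 2 / (real m + 1)) = \<eta> * (4 * hbin (Suc m)) - 2 * (\<eta> * (1 / (real m + 1)))"
          by (simp add: right_diff_distrib)
        show ?thesis using 1 2 3 4 7 unfolding 5 8 9 by (simp only: distrib_left)
      qed
    qed
  qed
  then show ?thesis by (simp add: c_def v_def)
qed

end

section \<open>Traces and eigenvalues\<close>

lemma mat_trace_mult_commute:
  assumes "A \<in> carrier_mat n m" "B \<in> carrier_mat m n"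
  shows "mat_trace (A * B) = mat_trace (B * A)"
proof -
  have "mat_trace (A * B) = (\<Sum>i<n. \<Sum>j<m. A $$ (i, j) * B $$ (j, i))"
    using assms by (auto simp: mat_trace_def scalar_prod_def atLeast0LessThan intro!: sum.cong)
  also have "\<dots> = (\<Sum>j<m. \<Sum>i<n. B $$ (j, i) * A $$ (i, j))"
    by (subst sum.swap) (simp add: mult.commute)
  also have "\<dots> = mat_trace (B * A)"
    using assms by (auto simp: mat_trace_def scalar_prod_def atLeast0LessThan intro!: sum.cong)
  finally show ?thesis .
qed

lemma mat_trace_similar:
  assumes "similar_mat A B"
  shows "mat_trace A = mat_trace B"
proof -
  obtain n P Q where *: "A \<in> carrier_mat n n" "B \<in> carrier_mat n n" "P \<in> carrier_mat n n" "Q \<in> carrier_mat n n"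
    "Q * P = 1\<^sub>m n" "A = P * B * Q"
    using similar_matD[OF assms] by auto
  have "mat_trace A = mat_trace (Q * (P * B))"
    unfolding *(6) using * by (intro mat_trace_mult_commute[of _ n n]) auto
  also have "Q * (P * B) = B"
    using * by (simp add: assoc_mult_mat[symmetric, of Q n n P n B n])
  finally show ?thesis .
qed

lemma upper_triangular_pow:
  fixes B :: "'a :: comm_ring_1 mat"
  assumes B: "B \<in> carrier_mat n n" "upper_triangular B"
  shows "upper_triangular (B ^\<^sub>m k) \<and> (\<forall>i<n. (B ^\<^sub>m k) $$ (i, i) = (B $$ (i, i)) ^ k)"
proof (induction k)
  case 0
  then show ?case using B by (auto simp: upper_triangular_def)
next
  case (Suc k)
  have C: "B ^\<^sub>m k \<in> carrier_mat n n" using B by (intro pow_carrier_mat)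
  have e: "(B ^\<^sub>m Suc k) $$ (i, j) = (\<Sum>l<n. (B ^\<^sub>m k) $$ (i, l) * B $$ (l, j))" if "i < n" "j < n" for i j
    using that B C by (simp add: scalar_prod_def atLeast0LessThan)
  have z: "(B ^\<^sub>m k) $$ (i, l) * B $$ (l, j) = 0" if "i < n" "l < n" "j < i \<or> (j = i \<and> l \<noteq> i)" for i j l
  proof (cases "l < i")
    case True
    then show ?thesis using Suc that C by (auto simp: upper_triangular_def)
  next
    case False
    then show ?thesis using B that by (auto simp: upper_triangular_def)
  qed
  show ?case
  proof (intro conjI allI impI)
    show "upper_triangular (B ^\<^sub>m Suc k)"
    proof (rule upper_triangularI)
      fix i j assume "j < i" "i < dim_row (B ^\<^sub>m Suc k)"
      then have ij: "i < n" "j < n" "j < i" using B C by auto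
      show "(B ^\<^sub>m Suc k) $$ (i, j) = 0"
        unfolding e[OF ij(1,2)] using ij z by (intro sum.neutral) auto
    qed
    fix i assume i: "i < n"
    have "(B ^\<^sub>m Suc k) $$ (i, i) = (\<Sum>l\<in>{i}. (B ^\<^sub>m k) $$ (i, l) * B $$ (l, i))"
      unfolding e[OF i i] using i z by (intro sum.mono_neutral_right) auto
    then show "(B ^\<^sub>m Suc k) $$ (i, i) = (B $$ (i, i)) ^ Suc k"
      using Suc i by (simp add: mult.commute)
  qed
qed

text \<open>\<open>A\<close> need not be diagonalisable, so Schur triangularisation is used. It
  accepts the eigenvalues in a prescribed order, which makes the i-th diagonal entry equal to
  \<open>a i\<close>.\<close>

lemma mat_trace_pow_eigenvalues:
  fixes A :: "complex mat"
  assumes A: "A \<in> carrier_mat n n" and cp: "char_poly A = (\<Prod>i<n. [:- a i, 1:])"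
  shows "mat_trace (A ^\<^sub>m k) = (\<Sum>i<n. a i ^ k)"
proof -
  let ?es = "map a [0..<n]"
  obtain B P Q where BPQ: "schur_decomposition A ?es = (B, P, Q)"
    by (cases "schur_decomposition A ?es") auto
  have "char_poly A = (\<Prod>e\<leftarrow>?es. [:- e, 1:])"
    unfolding cp by (simp add: prod.list_conv_set_nth atLeast0LessThan)
  from schur_decomposition[OF A this BPQ]
  have wit: "similar_mat_wit A B P Q" and ut: "upper_triangular B" and diag: "diag_mat B = ?es" by auto
  have B: "B \<in> carrier_mat n n" using similar_mat_witD2[OF A wit] by auto
  have "similar_mat (A ^\<^sub>m k) (B ^\<^sub>m k)"
    using similar_mat_wit_pow[OF wit] by (auto simp: similar_mat_def)
  then have "mat_trace (A ^\<^sub>m k) = mat_trace (B ^\<^sub>m k)" by (rule mat_trace_similar)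
  also have "\<dots> = (\<Sum>i<n. (B $$ (i, i)) ^ k)"
    using upper_triangular_pow[OF B ut, of k] B by (simp add: mat_trace_def)
  also have "\<dots> = (\<Sum>i<n. a i ^ k)"
  proof (intro sum.cong refl)
    fix i assume "i \<in> {..<n}"
    then have "diag_mat B ! i = a i" using diag by simp
    then show "(B $$ (i, i)) ^ k = a i ^ k" using \<open>i \<in> {..<n}\<close> B by (simp add: diag_mat_def)
  qed
  finally show ?thesis .
qed

section \<open>Integration by parts for the beta weight\<close>

text \<open>The fundamental theorem on \<open>{- m..m}\<close> and dominated convergence. The
  exceptional set \<open>S\<close> is for the kinks of the weight where two coordinates meet;
  continuity of \<open>h\<close> carries the argument across them.\<close>

lemma integral_derivative_eq_0:
  fixes h h' :: "real \<Rightarrow> real"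
  assumes "finite S" and cont: "continuous_on UNIV h"
    and deriv: "\<And>t. t \<notin> S \<Longrightarrow> (h has_real_derivative h' t) (at t)"
    and int: "integrable lborel h'"
    and lim: "(h \<longlongrightarrow> 0) at_top" "(h \<longlongrightarrow> 0) at_bot"
  shows "integral\<^sup>L lborel h' = 0"
proof -
  note [measurable] = borel_measurable_integrable[OF int]
  have eq: "integral\<^sup>L lborel (\<lambda>x. indicator {- real m..real m} x *\<^sub>R h' x) = h (real m) - h (- real m)" for m :: nat
  proof -
    have "(h' has_integral (h (real m) - h (- real m))) {- real m..real m}"
      using assms(1)
    proof (rule fundamental_theorem_of_calculus_interior_strong)
      show "continuous_on {- real m..real m} h" using cont continuous_on_subset by blast
      show "(h has_vector_derivative h' x) (at x)" if "x \<in> {- real m<..<real m} - S" for x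
        using deriv that by (auto simp: has_real_derivative_iff_has_vector_derivative)
    qed simp
    moreover have "set_integrable lborel {- real m..real m} h'"
      unfolding set_integrable_def using int by (rule integrable_mult_indicator[rotated]) simp
    ultimately show ?thesis
      using set_borel_integral_eq_integral(2)[of "{- real m..real m}" h']
      by (simp add: set_lebesgue_integral_def integral_unique)
  qed
  have "(\<lambda>m. integral\<^sup>L lborel (\<lambda>x. indicator {- real m..real m} x *\<^sub>R h' x)) \<longlonglongrightarrow> integral\<^sup>L lborel h'"
  proof (rule integral_dominated_convergence)
    show "integrable lborel (\<lambda>x. \<bar>h' x\<bar>)" using int by simp
    show "AE x in lborel. (\<lambda>m. indicator {- real m..real m} x *\<^sub>R h' x) \<longlonglongrightarrow> h' x"
    proof (intro AE_I2 tendsto_eventually)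
      fix x :: real
      show "\<forall>\<^sub>F m in sequentially. indicator {- real m..real m} x *\<^sub>R h' x = h' x"
        using eventually_ge_at_top[of "nat \<lceil>\<bar>x\<bar>\<rceil>"]
        by eventually_elim (auto simp: indicator_def; linarith)
    qed
    show "AE x in lborel. norm (indicator {- real m..real m} x *\<^sub>R h' x) \<le> \<bar>h' x\<bar>" for m
      by (intro AE_I2) (auto simp: indicator_def)
  qed measurable
  moreover have "(\<lambda>m. h (real m)) \<longlonglongrightarrow> 0"
    by (rule filterlim_compose[OF lim(1) filterlim_real_sequentially])
  moreover have "(\<lambda>m. h (- real m)) \<longlonglongrightarrow> 0"
    by (rule filterlim_compose[OF lim(2)])
      (rule filterlim_compose[OF filterlim_uminus_at_bot_at_top filterlim_real_sequentially])
  ultimately show ?thesis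
    unfolding eq using tendsto_diff[of "\<lambda>m. h (real m)" 0 sequentially "\<lambda>m. h (- real m)" 0]
      LIMSEQ_unique by fastforce
qed

text \<open>With derivatives in the form \<open>r p * \<phi> p t\<close>, the logarithmic
  derivatives add up although no factor is assumed to be nonzero.\<close>

lemma has_derivative_prod_log:
  fixes \<phi> :: "'a \<Rightarrow> real \<Rightarrow> real"
  assumes "finite I" "\<And>p. p \<in> I \<Longrightarrow> (\<phi> p has_real_derivative r p * \<phi> p t) (at t)"
  shows "((\<lambda>t. \<Prod>p\<in>I. \<phi> p t) has_real_derivative (\<Sum>p\<in>I. r p) * (\<Prod>p\<in>I. \<phi> p t)) (at t)"
  using assms
proof (induction I rule: finite_induct)
  case (insert p I)
  have "((\<lambda>t. \<phi> p t * (\<Prod>p\<in>I. \<phi> p t)) has_real_derivative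
      r p * \<phi> p t * (\<Prod>p\<in>I. \<phi> p t) + (\<Sum>p\<in>I. r p) * (\<Prod>p\<in>I. \<phi> p t) * \<phi> p t) (at t)"
    by (rule DERIV_mult) (use insert in auto)
  then show ?case using insert by (simp add: algebra_simps)
qed simp

lemma has_derivative_prod_mset:
  fixes g :: "'a \<Rightarrow> real \<Rightarrow> real"
  assumes "\<And>l. l \<in># L \<Longrightarrow> (g l has_real_derivative g' l) (at t)"
  shows "((\<lambda>t. \<Prod>l\<in>#L. g l t) has_real_derivative
    (\<Sum>l\<in>#L. g' l * (\<Prod>m\<in>#L - {#l#}. g m t))) (at t)"
  using assms
proof (induction L)
  case (add m L)
  have "((\<lambda>t. g m t * (\<Prod>l\<in>#L. g l t)) has_real_derivative
    g m t * (\<Sum>l\<in>#L. g' l * (\<Prod>m\<in>#L - {#l#}. g m t)) + g' m * (\<Prod>l\<in>#L. g l t)) (at t)"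
    using add by (intro DERIV_mult') auto
  moreover have "(\<Sum>l\<in>#L. g' l * (\<Prod>a\<in>#add_mset m L - {#l#}. g a t)) =
      (\<Sum>l\<in>#L. g m t * (g' l * (\<Prod>a\<in>#L - {#l#}. g a t)))"
    by (intro arg_cong[where f = sum_mset] image_mset_cong) (simp add: mult_ac)
  moreover have "\<dots> = g m t * (\<Sum>l\<in>#L. g' l * (\<Prod>a\<in>#L - {#l#}. g a t))"
    by (simp add: sum_mset_distrib_left image_mset.compositionality comp_def)
  ultimately show ?case by (simp add: add_ac)
qed simp

lemma powr_abs_has_derivative:
  fixes t c \<beta> :: real
  assumes "t \<noteq> c"
  shows "((\<lambda>t. \<bar>t - c\<bar> powr \<beta>) has_real_derivative \<beta> / (t - c) * \<bar>t - c\<bar> powr \<beta>) (at t)"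
proof (cases "t > c")
  case True
  have "((\<lambda>t. (t - c) powr \<beta>) has_real_derivative \<beta> / (t - c) * (t - c) powr \<beta>) (at t)"
    using True by (auto intro!: derivative_eq_intros simp: powr_diff field_simps)
  moreover have "\<forall>\<^sub>F u in nhds t. (u - c) powr \<beta> = \<bar>u - c\<bar> powr \<beta>"
    using eventually_nhds_in_open[of "{c<..}" t] True by (auto elim!: eventually_mono)
  ultimately show ?thesis using True by (subst DERIV_cong_ev[OF refl _ refl, symmetric]) auto
next
  case False
  then have lt: "t < c" using assms by simp
  have "((\<lambda>t. (c - t) powr \<beta>) has_real_derivative \<beta> / (t - c) * (c - t) powr \<beta>) (at t)"
    using lt by (auto intro!: derivative_eq_intros simp: powr_diff divide_simps)
      (simp add: algebra_simps)
  moreover have "\<forall>\<^sub>F u in nhds t. (c - u) powr \<beta> = \<bar>u - c\<bar> powr \<beta>"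
    using eventually_nhds_in_open[of "{..<c}" t] lt by (auto elim!: eventually_mono)
  ultimately show ?thesis using lt by (subst DERIV_cong_ev[OF refl _ refl, symmetric]) (auto simp: abs_if)
qed

lemma integrable_power_gaussian: "integrable lborel (\<lambda>t :: real. (1 + \<bar>t\<bar>) ^ K * exp (- t\<^sup>2 / 4))"
proof (rule Bochner_Integration.integrable_bound)
  \<comment> \<open>Variance 2 produces \<open>exp (- t\<^sup>2 / 4)\<close> up to
    \<open>sqrt (4 * pi)\<close>; the powers of \<open>\<bar>t - 0\<bar>\<close> below have the form
    of absolute normal moments.\<close>
  let ?d = "normal_density 0 (sqrt 2)"
  let ?g = "\<lambda>t :: real. (2 ^ K * sqrt (4 * pi)) * (?d t * \<bar>t - 0\<bar> ^ 0 + ?d t * \<bar>t - 0\<bar> ^ K)"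
  show "integrable lborel ?g"
    by (intro integrable_mult_right Bochner_Integration.integrable_add integrable_normal_moment_abs) simp_all
  show "AE t in lborel. norm ((1 + \<bar>t\<bar>) ^ K * exp (- t\<^sup>2 / 4)) \<le> norm (?g t)"
  proof (intro AE_I2)
    fix t :: real
    have "(1 + \<bar>t\<bar>) ^ K \<le> (2 * max 1 \<bar>t\<bar>) ^ K" by (intro power_mono) auto
    also have "\<dots> = 2 ^ K * max 1 \<bar>t\<bar> ^ K" by (simp add: power_mult_distrib)
    also have "max 1 \<bar>t\<bar> ^ K \<le> 1 + \<bar>t\<bar> ^ K" by (auto simp: max_def)
    finally have *: "(1 + \<bar>t\<bar>) ^ K \<le> 2 ^ K * (1 + \<bar>t\<bar> ^ K)" by simp
    have d: "sqrt (4 * pi) * ?d t = exp (- t\<^sup>2 / 4)" by (simp add: normal_density_def)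
    have "norm ((1 + \<bar>t\<bar>) ^ K * exp (- t\<^sup>2 / 4)) = (1 + \<bar>t\<bar>) ^ K * exp (- t\<^sup>2 / 4)" by (simp add: abs_mult)
    also have "\<dots> \<le> 2 ^ K * (1 + \<bar>t\<bar> ^ K) * exp (- t\<^sup>2 / 4)" using * by (intro mult_right_mono) auto
    also have "\<dots> = ?g t" unfolding d[symmetric] by (simp add: algebra_simps)
    finally show "norm ((1 + \<bar>t\<bar>) ^ K * exp (- t\<^sup>2 / 4)) \<le> norm (?g t)" by simp
  qed
qed simp

lemma power_gaussian_tendsto_0:
  shows "((\<lambda>t :: real. (1 + \<bar>t\<bar>) ^ K * exp (- t\<^sup>2 / 4)) \<longlongrightarrow> 0) at_top" (is "(?f \<longlongrightarrow> 0) _")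
    and "((\<lambda>t :: real. (1 + \<bar>t\<bar>) ^ K * exp (- t\<^sup>2 / 4)) \<longlongrightarrow> 0) at_bot"
proof -
  have "((\<lambda>u :: real. (u + 1) ^ K / exp (u + 1)) \<longlongrightarrow> 0) at_top"
    by (rule filterlim_compose[OF tendsto_power_div_exp_0])
      (rule filterlim_tendsto_add_at_top[OF tendsto_const filterlim_ident, of 1, simplified add.commute])
  then have "((\<lambda>u :: real. exp 2 * ((u + 1) ^ K / exp (u + 1))) \<longlongrightarrow> exp 2 * 0) at_top"
    by (intro tendsto_mult tendsto_const)
  then have lim: "((\<lambda>u :: real. exp 2 * ((u + 1) ^ K / exp (u + 1))) \<longlongrightarrow> 0) at_top" by simp
  have "\<forall>\<^sub>F u in at_top. norm (?f u) \<le> exp 2 * ((u + 1) ^ K / exp (u + 1))"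
    using eventually_ge_at_top[of 0]
  proof eventually_elim
    case (elim u)
    \<comment> \<open>This is (u/2 - 1)^2 \<ge> 0; it reduces Gaussian decay to exponential decay in
      \<open>u + 1\<close>, the base of the power.\<close>
    have "- u\<^sup>2 / 4 \<le> 2 - (u + 1)"
      using zero_le_power2[of "u / 2 - 1"] by (simp add: power2_eq_square algebra_simps)
    then have "exp (- u\<^sup>2 / 4) \<le> exp 2 / exp (u + 1)" by (simp flip: exp_diff)
    then have "(u + 1) ^ K * exp (- u\<^sup>2 / 4) \<le> (u + 1) ^ K * (exp 2 / exp (u + 1))"
      using elim by (intro mult_left_mono) auto
    then show ?case using elim by (simp add: abs_mult mult_ac add_ac)
  qed
  then show top: "(?f \<longlongrightarrow> 0) at_top" using lim by (rule Lim_null_comparison)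
  have "((\<lambda>t. ?f (- t)) \<longlongrightarrow> 0) at_bot"
    using top by (rule filterlim_compose) (rule filterlim_uminus_at_top_at_bot)
  then show "(?f \<longlongrightarrow> 0) at_bot" by simp
qed


section \<open>Polynomially bounded functions against the Gaussian factor\<close>

definition growth :: "nat \<Rightarrow> (nat \<Rightarrow> real) \<Rightarrow> real" where
  "growth n x = (\<Prod>i<n. 1 + \<bar>x i\<bar>)"

definition gaussian_factor :: "nat \<Rightarrow> (nat \<Rightarrow> real) \<Rightarrow> real" where
  "gaussian_factor n x = (\<Prod>i<n. exp (- (x i)\<^sup>2 / 4))"

text \<open>Powers of \<open>growth\<close> factorise over the coordinates, so domination splits
  into one-dimensional Gaussian integrals; \<open>growth\<close> still dominates each coordinate and
  each difference. The bound is asked for every \<open>x\<close>, so it applies to updates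
  \<open>x(i := t)\<close> at once.\<close>

definition poly_bounded :: "nat \<Rightarrow> ((nat \<Rightarrow> real) \<Rightarrow> real) \<Rightarrow> bool" where
  "poly_bounded n f \<longleftrightarrow> (\<exists>C K. \<forall>x. \<bar>f x\<bar> \<le> C * growth n x ^ K)"

lemma growth_ge_1: "growth n x \<ge> 1"
  unfolding growth_def by (intro prod_ge_1) auto

lemma growth_ge_component:
  assumes "i < n"
  shows "1 + \<bar>x i\<bar> \<le> growth n x"
proof -
  have "1 + \<bar>x i\<bar> = (\<Prod>k\<in>{i}. 1 + \<bar>x k\<bar>)" by simp
  also have "\<dots> \<le> growth n x"
    unfolding growth_def using assms by (intro prod_mono2) auto
  finally show ?thesis .
qed

lemma growth_ge_diff:
  assumes "i < j" "j < n"
  shows "\<bar>x i - x j\<bar> \<le> growth n x"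
proof -
  have "\<bar>x i - x j\<bar> \<le> (1 + \<bar>x i\<bar>) * (1 + \<bar>x j\<bar>)"
    using abs_triangle_ineq4[of "x i" "x j"] mult_nonneg_nonneg[of "\<bar>x i\<bar>" "\<bar>x j\<bar>"]
    unfolding distrib_left distrib_right by linarith
  also have "\<dots> = (\<Prod>k\<in>{i, j}. 1 + \<bar>x k\<bar>)" using assms by simp
  also have "\<dots> \<le> growth n x"
    unfolding growth_def using assms by (intro prod_mono2) auto
  finally show ?thesis .
qed

lemma poly_boundedE:
  assumes "poly_bounded n f"
  obtains C K where "C \<ge> 0" "\<And>x. \<bar>f x\<bar> \<le> C * growth n x ^ K"
proof -
  obtain C K where *: "\<And>x. \<bar>f x\<bar> \<le> C * growth n x ^ K" using assms by (auto simp: poly_bounded_def)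
  have "\<bar>f x\<bar> \<le> \<bar>C\<bar> * growth n x ^ K" for x
  proof -
    have "C * growth n x ^ K \<le> \<bar>C\<bar> * growth n x ^ K"
      using growth_ge_1[of n x] by (intro mult_right_mono) auto
    then show ?thesis using *[of x] by linarith
  qed
  then show ?thesis using that[of "\<bar>C\<bar>" K] by simp
qed

lemma poly_boundedI: "(\<And>x. \<bar>f x\<bar> \<le> C * growth n x ^ K) \<Longrightarrow> poly_bounded n f"
  by (auto simp: poly_bounded_def)

lemma poly_bounded_const [simp]: "poly_bounded n (\<lambda>_. c)"
  by (rule poly_boundedI[where K = 0 and C = "\<bar>c\<bar>"]) simp

lemma poly_bounded_component:
  assumes "i < n"
  shows "poly_bounded n (\<lambda>x. x i)"
proof (rule poly_boundedI[where K = 1 and C = 1])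
  fix x :: "nat \<Rightarrow> real"
  show "\<bar>x i\<bar> \<le> 1 * growth n x ^ 1"
    using growth_ge_component[OF assms, of x] by simp
qed

lemma poly_bounded_mult:
  assumes "poly_bounded n f" "poly_bounded n g"
  shows "poly_bounded n (\<lambda>x. f x * g x)"
proof -
  obtain C K where f: "C \<ge> 0" "\<And>x. \<bar>f x\<bar> \<le> C * growth n x ^ K" using poly_boundedE[OF assms(1)] by blast
  obtain D M where g: "D \<ge> 0" "\<And>x. \<bar>g x\<bar> \<le> D * growth n x ^ M" using poly_boundedE[OF assms(2)] by blast
  have "\<bar>f x * g x\<bar> \<le> (C * D) * growth n x ^ (K + M)" for x
    using mult_mono[OF f(2)[of x] g(2)[of x]] f(1) growth_ge_1[of n x] by (simp add: abs_mult power_add mult_ac)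
  then show ?thesis by (rule poly_boundedI)
qed

lemma poly_bounded_add:
  assumes "poly_bounded n f" "poly_bounded n g"
  shows "poly_bounded n (\<lambda>x. f x + g x)"
proof -
  obtain C K where f: "C \<ge> 0" "\<And>x. \<bar>f x\<bar> \<le> C * growth n x ^ K" using poly_boundedE[OF assms(1)] by blast
  obtain D M where g: "D \<ge> 0" "\<And>x. \<bar>g x\<bar> \<le> D * growth n x ^ M" using poly_boundedE[OF assms(2)] by blast
  have "\<bar>f x + g x\<bar> \<le> (C + D) * growth n x ^ (K + M)" for x
  proof -
    have "C * growth n x ^ K \<le> C * growth n x ^ (K + M)" "D * growth n x ^ M \<le> D * growth n x ^ (K + M)"
      using f(1) g(1) growth_ge_1[of n x] by (auto intro!: mult_left_mono power_increasing)
    then show ?thesis using f(2)[of x] g(2)[of x] by (simp add: distrib_right)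
  qed
  then show ?thesis by (rule poly_boundedI)
qed

lemma poly_bounded_uminus: "poly_bounded n f \<Longrightarrow> poly_bounded n (\<lambda>x. - f x)"
  by (simp add: poly_bounded_def)

lemma poly_bounded_diff: "poly_bounded n f \<Longrightarrow> poly_bounded n g \<Longrightarrow> poly_bounded n (\<lambda>x. f x - g x)"
  using poly_bounded_add[OF _ poly_bounded_uminus, of n f g] by simp

lemma poly_bounded_divide_const: "poly_bounded n f \<Longrightarrow> poly_bounded n (\<lambda>x. f x / c)"
  unfolding divide_inverse by (intro poly_bounded_mult) auto

lemma poly_bounded_power: "poly_bounded n f \<Longrightarrow> poly_bounded n (\<lambda>x. f x ^ k)"
  by (induction k) (auto intro: poly_bounded_mult)

lemma poly_bounded_sum: "(\<And>i. i \<in> I \<Longrightarrow> poly_bounded n (f i)) \<Longrightarrow> poly_bounded n (\<lambda>x. \<Sum>i\<in>I. f i x)"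
  by (induction I rule: infinite_finite_induct) (auto intro: poly_bounded_add)

lemma poly_bounded_prod: "(\<And>i. i \<in> I \<Longrightarrow> poly_bounded n (f i)) \<Longrightarrow> poly_bounded n (\<lambda>x. \<Prod>i\<in>I. f i x)"
  by (induction I rule: infinite_finite_induct) (auto intro: poly_bounded_mult)

lemma poly_bounded_sum_mset: "(\<And>l. l \<in># L \<Longrightarrow> poly_bounded n (f l)) \<Longrightarrow> poly_bounded n (\<lambda>x. \<Sum>l\<in>#L. f l x)"
  by (induction L) (auto intro: poly_bounded_add)

lemma poly_bounded_prod_mset: "(\<And>l. l \<in># L \<Longrightarrow> poly_bounded n (f l)) \<Longrightarrow> poly_bounded n (\<lambda>x. \<Prod>l\<in>#L. f l x)"
  by (induction L) (auto intro: poly_bounded_mult)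

lemma poly_bounded_powr:
  fixes \<gamma> :: real
  assumes "\<gamma> \<ge> 0" "i < j" "j < n"
  shows "poly_bounded n (\<lambda>x. \<bar>x i - x j\<bar> powr \<gamma>)"
proof (rule poly_boundedI[where C = 1 and K = "nat \<lceil>\<gamma>\<rceil>"])
  fix x :: "nat \<Rightarrow> real"
  have "\<bar>x i - x j\<bar> powr \<gamma> \<le> growth n x powr \<gamma>"
    using growth_ge_diff[OF assms(2,3), of x] assms(1) by (intro powr_mono2) auto
  also have "\<dots> \<le> growth n x powr real (nat \<lceil>\<gamma>\<rceil>)"
    using growth_ge_1[of n x] by (intro powr_mono) linarith+
  also have "\<dots> = growth n x ^ nat \<lceil>\<gamma>\<rceil>"
    using growth_ge_1[of n x] by (intro powr_realpow) simp
  finally show "\<bar>\<bar>x i - x j\<bar> powr \<gamma>\<bar> \<le> 1 * growth n x ^ nat \<lceil>\<gamma>\<rceil>" by simp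
qed

lemma integrable_poly_bounded:
  assumes "poly_bounded n f" and [measurable]: "f \<in> borel_measurable (PiM {..<n} (\<lambda>_. lborel))"
  shows "integrable (PiM {..<n} (\<lambda>_. lborel)) (\<lambda>x. f x * gaussian_factor n x)"
proof -
  interpret product_sigma_finite "\<lambda>_::nat. lborel :: real measure" ..
  obtain C K where f: "C \<ge> 0" "\<And>x. \<bar>f x\<bar> \<le> C * growth n x ^ K" using poly_boundedE[OF assms(1)] by blast
  show ?thesis
  proof (rule Bochner_Integration.integrable_bound)
    show "integrable (PiM {..<n} (\<lambda>_. lborel)) (\<lambda>x. C * (\<Prod>i<n. (1 + \<bar>x i\<bar>) ^ K * exp (- (x i)\<^sup>2 / 4)))"
      by (intro integrable_mult_right product_integrable_prod integrable_power_gaussian) auto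
    show "AE x in PiM {..<n} (\<lambda>_. lborel). norm (f x * gaussian_factor n x) \<le>
        norm (C * (\<Prod>i<n. (1 + \<bar>x i\<bar>) ^ K * exp (- (x i)\<^sup>2 / 4)))"
    proof (intro AE_I2)
      fix x :: "nat \<Rightarrow> real"
      have g: "gaussian_factor n x \<ge> 0" unfolding gaussian_factor_def by (intro prod_nonneg) simp
      have "norm (f x * gaussian_factor n x) = \<bar>f x\<bar> * gaussian_factor n x" using g by (simp add: abs_mult)
      also have "\<dots> \<le> C * growth n x ^ K * gaussian_factor n x" using f(2) g by (intro mult_right_mono) auto
      also have "\<dots> = C * (\<Prod>i<n. (1 + \<bar>x i\<bar>) ^ K * exp (- (x i)\<^sup>2 / 4))"
        by (simp add: growth_def gaussian_factor_def prod.distrib prod_power_distrib)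
      finally show "norm (f x * gaussian_factor n x) \<le>
        norm (C * (\<Prod>i<n. (1 + \<bar>x i\<bar>) ^ K * exp (- (x i)\<^sup>2 / 4)))" by simp
    qed
    show "(\<lambda>x. f x * gaussian_factor n x) \<in> borel_measurable (PiM {..<n} (\<lambda>_. lborel))"
      unfolding gaussian_factor_def by measurable
  qed
qed

text \<open>On a line in direction \<open>i\<close> the other coordinates contribute constants only,
  so one bound serves both integrability in \<open>t\<close> and decay at both ends.\<close>

lemma poly_bounded_slice:
  assumes "poly_bounded n f" "i < n"
  obtains C K where "\<And>t. \<bar>f (x(i := t)) * gaussian_factor n (x(i := t))\<bar> \<le> C * ((1 + \<bar>t\<bar>) ^ K * exp (- t\<^sup>2 / 4))"
proof -
  obtain C K where f: "C \<ge> 0" "\<And>x. \<bar>f x\<bar> \<le> C * growth n x ^ K" using poly_boundedE[OF assms(1)] by blast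
  define a where "a = (\<Prod>j\<in>{..<n} - {i}. 1 + \<bar>x j\<bar>)"
  define b where "b = (\<Prod>j\<in>{..<n} - {i}. exp (- (x j)\<^sup>2 / 4))"
  have ab: "b \<ge> 0" by (auto simp: b_def intro!: prod_nonneg)
  have gr: "growth n (x(i := t)) = (1 + \<bar>t\<bar>) * a" for t
    unfolding growth_def a_def using assms(2) by (subst prod.remove[of _ i]) (auto intro!: prod.cong)
  have ga: "gaussian_factor n (x(i := t)) = exp (- t\<^sup>2 / 4) * b" for t
    unfolding gaussian_factor_def b_def using assms(2) by (subst prod.remove[of _ i]) (auto intro!: prod.cong)
  show ?thesis
  proof (rule that[of "C * a ^ K * b" K])
    fix t
    have "\<bar>f (x(i := t)) * gaussian_factor n (x(i := t))\<bar> = \<bar>f (x(i := t))\<bar> * (exp (- t\<^sup>2 / 4) * b)"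
      using ab by (simp add: ga abs_mult)
    also have "\<dots> \<le> C * ((1 + \<bar>t\<bar>) * a) ^ K * (exp (- t\<^sup>2 / 4) * b)"
      using f(2)[of "x(i := t)"] ab by (intro mult_right_mono) (auto simp: gr)
    finally show "\<bar>f (x(i := t)) * gaussian_factor n (x(i := t))\<bar> \<le> C * a ^ K * b * ((1 + \<bar>t\<bar>) ^ K * exp (- t\<^sup>2 / 4))"
      by (simp add: power_mult_distrib mult_ac)
  qed
qed

section \<open>Repulsion, its logarithmic derivative, and integration by parts\<close>

definition index_pairs :: "nat \<Rightarrow> (nat \<times> nat) set" where
  "index_pairs n = (SIGMA j:{..<n}. {..<j})"

lemma finite_index_pairs [simp]: "finite (index_pairs n)"
  by (simp add: index_pairs_def)

lemma index_pairsD: "(j, i) \<in> index_pairs n \<Longrightarrow> i < j \<and> j < n"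
  by (auto simp: index_pairs_def)

lemma sum_index_pairs:
  fixes f :: "nat \<Rightarrow> nat \<Rightarrow> real"
  assumes "\<And>i j. f i j = f j i"
  shows "2 * (\<Sum>(j, i)\<in>index_pairs n. f i j) = (\<Sum>i<n. \<Sum>j<n. f i j) - (\<Sum>i<n. f i i)"
proof -
  have "(\<Sum>(j, i)\<in>index_pairs n. f i j) = (\<Sum>j<n. \<Sum>i<j. f i j)"
    unfolding index_pairs_def by (subst sum.Sigma) auto
  moreover have "2 * (\<Sum>j<n. \<Sum>i<j. f i j) = (\<Sum>i<n. \<Sum>j<n. f i j) - (\<Sum>i<n. f i i)"
    by (induction n) (use assms in \<open>auto simp: sum.distrib algebra_simps\<close>)
  ultimately show ?thesis by simp
qed

definition repulsion :: "nat \<Rightarrow> real \<Rightarrow> (nat \<Rightarrow> real) \<Rightarrow> real" where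
  "repulsion n \<beta> x = (\<Prod>(j, i)\<in>index_pairs n. \<bar>x i - x j\<bar> powr \<beta>)"

lemma beta_weight_eq: "beta_weight n \<beta> x = repulsion n \<beta> x * gaussian_factor n x"
proof -
  have "(\<Prod>j<n. \<Prod>i<j. \<bar>x i - x j\<bar> powr \<beta>) = repulsion n \<beta> x"
    unfolding repulsion_def index_pairs_def by (subst prod.Sigma) auto
  moreover have "exp (- (1/4) * (\<Sum>i<n. (x i)\<^sup>2)) = gaussian_factor n x"
    by (simp add: gaussian_factor_def sum_distrib_left flip: exp_sum)
  ultimately show ?thesis by (simp add: beta_weight_def)
qed

lemma repulsion_measurable [measurable]:
  "repulsion n \<beta> \<in> borel_measurable (PiM {..<n} (\<lambda>_. lborel))"
  unfolding repulsion_def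
proof (intro borel_measurable_prod)
  fix p assume "p \<in> index_pairs n"
  then obtain i j where p: "p = (j, i)" "i < n" "j < n" by (cases p) (auto dest!: index_pairsD)
  have [measurable]: "(\<lambda>x. x i) \<in> borel_measurable (PiM {..<n} (\<lambda>_. lborel))"
    "(\<lambda>x. x j) \<in> borel_measurable (PiM {..<n} (\<lambda>_. lborel))"
    using measurable_component_singleton[of i "{..<n}" "\<lambda>_. lborel"]
      measurable_component_singleton[of j "{..<n}" "\<lambda>_. lborel"] p by auto
  show "(\<lambda>x. case p of (j, i) \<Rightarrow> \<bar>x i - x j\<bar> powr \<beta>) \<in> borel_measurable (PiM {..<n} (\<lambda>_. lborel))"
    unfolding p(1) prod.case by measurable
qed

lemma component_measurable: "i < n \<Longrightarrow> (\<lambda>x. x i) \<in> borel_measurable (PiM {..<n} (\<lambda>_. lborel :: real measure))"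
  using measurable_component_singleton[of i "{..<n}" "\<lambda>_. lborel"] by simp

lemma poly_bounded_repulsion: "\<beta> \<ge> 0 \<Longrightarrow> poly_bounded n (repulsion n \<beta>)"
  unfolding repulsion_def
  by (intro poly_bounded_prod) (auto dest!: index_pairsD intro!: poly_bounded_powr split: prod.splits)

text \<open>The assumption \<beta> \<ge> 1 enters here: the quotient keeps the exponent \<beta> - 1
  \<ge> 0 on the factor concerned, so the singularity of the force is cancelled and not merely
  integrable.\<close>

lemma poly_bounded_repulsion_divide:
  assumes "\<beta> \<ge> 1" "(j, i) \<in> index_pairs n"
  shows "poly_bounded n (\<lambda>x. repulsion n \<beta> x / (x i - x j))"
proof -
  have ij: "i < j" "j < n" using index_pairsD[OF assms(2)] by auto
  let ?g = "\<lambda>x. \<bar>x i - x j\<bar> powr (\<beta> - 1) * (\<Prod>(j, i)\<in>index_pairs n - {(j, i)}. \<bar>x i - x j\<bar> powr \<beta>)"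
  have "poly_bounded n ?g"
    using assms ij
    by (intro poly_bounded_mult poly_bounded_prod) (auto dest!: index_pairsD intro!: poly_bounded_powr split: prod.splits)
  then obtain C K where *: "\<And>x. \<bar>?g x\<bar> \<le> C * growth n x ^ K" by (rule poly_boundedE) blast
  have "\<bar>repulsion n \<beta> x / (x i - x j)\<bar> = \<bar>?g x\<bar>" if "x i \<noteq> x j" for x
  proof -
    have "repulsion n \<beta> x = \<bar>x i - x j\<bar> powr \<beta> * (\<Prod>(j, i)\<in>index_pairs n - {(j, i)}. \<bar>x i - x j\<bar> powr \<beta>)"
      unfolding repulsion_def using assms(2) by (subst prod.remove) auto
    then show ?thesis using that by (simp add: abs_mult powr_diff)
  qed
  \<comment> \<open>At a collision the quotient is 0 by the convention for division by zero.\<close>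
  moreover have "\<bar>repulsion n \<beta> x / (x i - x j)\<bar> \<le> \<bar>?g x\<bar>" if "x i = x j" for x using that by simp
  ultimately have "\<bar>repulsion n \<beta> x / (x i - x j)\<bar> \<le> C * growth n x ^ K" for x
    using *[of x] by (cases "x i = x j") fastforce+
  then show ?thesis by (rule poly_boundedI)
qed

text \<open>The partial derivative in coordinate \<open>k\<close> of the logarithm of
  \<open>\<bar>x i - x j\<bar> powr \<beta>\<close>, away from collisions.\<close>

definition log_force :: "real \<Rightarrow> nat \<Rightarrow> nat \<times> nat \<Rightarrow> (nat \<Rightarrow> real) \<Rightarrow> real" where
  "log_force \<beta> k = (\<lambda>(j, i) x. \<beta> * (of_bool (k = i) - of_bool (k = j)) / (x i - x j))"

text \<open>Where coordinate \<open>k\<close> meets no other one, \<open>F\<close> is the k-th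
  partial derivative of \<open>f * beta_weight\<close>. It integrates to 0 along each line in
  direction \<open>k\<close>, and Fubini gives the rest.\<close>

lemma integral_by_parts_beta_weight:
  fixes f f' :: "(nat \<Rightarrow> real) \<Rightarrow> real"
  assumes \<beta>: "\<beta> \<ge> 1" and k: "k < n"
    and f: "poly_bounded n f" "f \<in> borel_measurable (PiM {..<n} (\<lambda>_. lborel))"
    and f': "poly_bounded n f'" "f' \<in> borel_measurable (PiM {..<n} (\<lambda>_. lborel))"
    and deriv: "\<And>x t. ((\<lambda>t. f (x(k := t))) has_real_derivative f' (x(k := t))) (at t)"
  defines "F \<equiv> \<lambda>x. (f' x + f x * (\<Sum>p\<in>index_pairs n. log_force \<beta> k p x) - f x * x k / 2) * beta_weight n \<beta> x"
  shows "integrable (PiM {..<n} (\<lambda>_. lborel)) F" "integral\<^sup>L (PiM {..<n} (\<lambda>_. lborel)) F = 0"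
proof -
  interpret product_sigma_finite "\<lambda>_::nat. lborel :: real measure" ..
  let ?M = "PiM {..<n} (\<lambda>_. lborel :: real measure)"
  \<comment> \<open>The singular quotients are attached to \<open>repulsion\<close>, which keeps
    them polynomially bounded; \<beta> \<ge> 1 is needed for this.\<close>
  define g where "g x = f' x * repulsion n \<beta> x +
    (\<Sum>(j, i)\<in>index_pairs n. f x * \<beta> * (of_bool (k = i) - of_bool (k = j)) * (repulsion n \<beta> x / (x i - x j))) -
    f x * (x k / 2) * repulsion n \<beta> x" for x
  have Fg: "F x = g x * gaussian_factor n x" for x
    unfolding F_def g_def beta_weight_eq log_force_def
    by (simp add: sum_distrib_left sum_distrib_right algebra_simps split_beta diff_divide_distrib)
  have term_pb: "poly_bounded n (\<lambda>x. case p of (j, i) \<Rightarrow>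
      f x * \<beta> * (of_bool (k = i) - of_bool (k = j)) * (repulsion n \<beta> x / (x i - x j)))"
    if "p \<in> index_pairs n" for p
    using that \<beta>
    by (cases p, simp only: prod.case)
      (intro poly_bounded_mult poly_bounded_repulsion_divide poly_bounded_const f)
  have g_pb: "poly_bounded n g"
    unfolding g_def using \<beta> f f' k
    by (intro poly_bounded_diff poly_bounded_add poly_bounded_mult poly_bounded_sum poly_bounded_divide_const
        poly_bounded_component poly_bounded_repulsion term_pb) auto
  note [measurable] = f(2) f'(2) component_measurable[OF k]
  have g_meas [measurable]: "g \<in> borel_measurable ?M"
  proof -
    have "(\<lambda>x. case p of (j, i) \<Rightarrow> f x * \<beta> * (of_bool (k = i) - of_bool (k = j)) * (repulsion n \<beta> x / (x i - x j)))
        \<in> borel_measurable ?M" if pI: "p \<in> index_pairs n" for p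
    proof -
      obtain j i where p: "p = (j, i)" by (cases p)
      have "i < n" "j < n" using index_pairsD[of j i n] pI p by auto
      note [measurable] = component_measurable[OF \<open>i < n\<close>] component_measurable[OF \<open>j < n\<close>]
      show ?thesis unfolding p prod.case by measurable
    qed
    then have sum_meas: "(\<lambda>x. \<Sum>(j, i)\<in>index_pairs n. f x * \<beta> * (of_bool (k = i) - of_bool (k = j)) * (repulsion n \<beta> x / (x i - x j)))
        \<in> borel_measurable ?M" by (intro borel_measurable_sum)
    show ?thesis unfolding g_def[abs_def]
      by (intro borel_measurable_add borel_measurable_diff borel_measurable_times borel_measurable_divide
          borel_measurable_const repulsion_measurable component_measurable f(2) f'(2) k sum_meas)
  qed
  show int: "integrable ?M F"
    unfolding Fg[abs_def] by (rule integrable_poly_bounded[OF g_pb g_meas])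
  have "integral\<^sup>L lborel (\<lambda>t. F (x(k := t))) = 0" if x: "x \<in> space (PiM ({..<n} - {k}) (\<lambda>_. lborel))" for x
  proof -
    \<comment> \<open>At the value of another coordinate the weight need not be differentiable in
      \<open>t\<close>, as \<beta> = 1 shows.\<close>
    define S where "S = x ` ({..<n} - {k})"
    define h where "h t = f (x(k := t)) * beta_weight n \<beta> (x(k := t))" for t
    have upd: "(\<lambda>t. x(k := t)) \<in> measurable lborel ?M"
      using measurable_component_update[OF x, of k] k by (simp add: insert_absorb)
    have F_meas: "(\<lambda>t. F (x(k := t))) \<in> borel_measurable lborel"
      using measurable_compose[OF upd borel_measurable_integrable[OF int]] .
    obtain C K where F_bd: "\<And>t. \<bar>F (x(k := t))\<bar> \<le> C * ((1 + \<bar>t\<bar>) ^ K * exp (- t\<^sup>2 / 4))"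
    proof -
      obtain C K where "\<And>t. \<bar>g (x(k := t)) * gaussian_factor n (x(k := t))\<bar> \<le> C * ((1 + \<bar>t\<bar>) ^ K * exp (- t\<^sup>2 / 4))"
        using poly_bounded_slice[OF g_pb k, of x] by blast
      then show ?thesis using that[of C K] by (simp only: Fg)
    qed
    have "poly_bounded n (\<lambda>x. f x * repulsion n \<beta> x)"
      using \<beta> by (intro poly_bounded_mult f poly_bounded_repulsion) auto
    then obtain D J where "\<And>t. \<bar>f (x(k := t)) * repulsion n \<beta> (x(k := t)) * gaussian_factor n (x(k := t))\<bar>
        \<le> D * ((1 + \<bar>t\<bar>) ^ J * exp (- t\<^sup>2 / 4))"
      using poly_bounded_slice[of n "\<lambda>x. f x * repulsion n \<beta> x" k x] k by blast
    then have h_bd: "\<bar>h t\<bar> \<le> D * ((1 + \<bar>t\<bar>) ^ J * exp (- t\<^sup>2 / 4))" for t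
      by (simp only: h_def beta_weight_eq mult.assoc)
    show ?thesis
    proof (rule integral_derivative_eq_0)
      show "finite S" by (simp add: S_def)
      show "integrable lborel (\<lambda>t. F (x(k := t)))"
      proof (rule Bochner_Integration.integrable_bound)
        show "integrable lborel (\<lambda>t. C * ((1 + \<bar>t\<bar>) ^ K * exp (- t\<^sup>2 / 4)))"
          by (intro integrable_mult_right integrable_power_gaussian)
        show "AE t in lborel. norm (F (x(k := t))) \<le> norm (C * ((1 + \<bar>t\<bar>) ^ K * exp (- t\<^sup>2 / 4)))"
        proof (intro AE_I2)
          fix t
          show "norm (F (x(k := t))) \<le> norm (C * ((1 + \<bar>t\<bar>) ^ K * exp (- t\<^sup>2 / 4)))"
            using F_bd[of t] abs_ge_self[of "C * ((1 + \<bar>t\<bar>) ^ K * exp (- t\<^sup>2 / 4))"]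
            unfolding real_norm_def by linarith
        qed
      qed (rule F_meas)
      have "((\<lambda>t. D * ((1 + \<bar>t\<bar>) ^ J * exp (- t\<^sup>2 / 4))) \<longlongrightarrow> D * 0) at_top"
        "((\<lambda>t. D * ((1 + \<bar>t\<bar>) ^ J * exp (- t\<^sup>2 / 4))) \<longlongrightarrow> D * 0) at_bot"
        by (intro tendsto_mult tendsto_const power_gaussian_tendsto_0)+
      then show "(h \<longlongrightarrow> 0) at_top" "(h \<longlongrightarrow> 0) at_bot"
        using h_bd by (auto elim!: Lim_null_comparison[rotated])
      have cont_f: "continuous_on UNIV (\<lambda>t. f (x(k := t)))"
        using deriv by (meson DERIV_isCont continuous_at_imp_continuous_on)
      have c: "continuous_on UNIV (\<lambda>t. (x(k := t)) i)" for i
        by (cases "i = k") (auto intro!: continuous_intros)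
      have cp: "continuous_on UNIV (\<lambda>t. case p of (j, i) \<Rightarrow> \<bar>(x(k := t)) i - (x(k := t)) j\<bar> powr \<beta>)" for p
        by (cases p, simp only: prod.case)
          (intro continuous_on_powr' continuous_on_rabs continuous_on_diff c continuous_on_const, use \<beta> in auto)
      have "continuous_on UNIV (\<lambda>t. beta_weight n \<beta> (x(k := t)))"
        unfolding beta_weight_eq repulsion_def gaussian_factor_def
        by (intro continuous_on_mult continuous_on_prod cp continuous_on_exp continuous_on_divide
            continuous_on_minus continuous_on_power c continuous_on_const) auto
      then show "continuous_on UNIV h"
        unfolding h_def using cont_f by (intro continuous_on_mult)
      fix t assume t: "t \<notin> S"
      have "((\<lambda>t. repulsion n \<beta> (x(k := t))) has_real_derivative
          (\<Sum>p\<in>index_pairs n. log_force \<beta> k p (x(k := t))) * repulsion n \<beta> (x(k := t))) (at t)"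
        unfolding repulsion_def
      proof (rule has_derivative_prod_log, simp)
        fix p assume "p \<in> index_pairs n"
        then obtain i j where p: "p = (j, i)" "i < j" "j < n" by (cases p) (auto dest!: index_pairsD)
        consider "k = i" | "k = j" | "k \<noteq> i" "k \<noteq> j" by blast
        then show "((\<lambda>t. case p of (j, i) \<Rightarrow> \<bar>(x(k := t)) i - (x(k := t)) j\<bar> powr \<beta>) has_real_derivative
          log_force \<beta> k p (x(k := t)) * (case p of (j, i) \<Rightarrow> \<bar>(x(k := t)) i - (x(k := t)) j\<bar> powr \<beta>)) (at t)"
        proof cases
          case 1
          have "t \<noteq> x j" using t p 1 by (auto simp: S_def)
          from powr_abs_has_derivative[OF this, of \<beta>] show ?thesis
            using p 1 by (simp add: log_force_def)
        next
          case 2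
          have "t \<noteq> x i" using t p 2 by (auto simp: S_def)
          have "\<beta> / (t - x i) = - \<beta> / (x i - t)"
            using minus_divide_divide[of \<beta> "t - x i"] by (simp only: minus_diff_eq)
          with powr_abs_has_derivative[OF \<open>t \<noteq> x i\<close>, of \<beta>] show ?thesis
            using p 2 by (simp add: log_force_def abs_minus_commute[of "x i"])
        qed (simp add: p log_force_def)
      qed
      moreover have "((\<lambda>t. gaussian_factor n (x(k := t))) has_real_derivative
          (\<Sum>i<n. - of_bool (i = k) * t / 2) * gaussian_factor n (x(k := t))) (at t)"
        unfolding gaussian_factor_def
        by (rule has_derivative_prod_log, simp) (auto intro!: derivative_eq_intros)
      moreover have "(\<Sum>i<n. - of_bool (i = k) * t / 2) = - t / 2"
        using k by (simp add: sum_negf of_bool_def if_distrib[of "\<lambda>c. c * _ / _"] cong: if_cong)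
      ultimately have "((\<lambda>t. beta_weight n \<beta> (x(k := t))) has_real_derivative
          ((\<Sum>p\<in>index_pairs n. log_force \<beta> k p (x(k := t))) - t / 2) * beta_weight n \<beta> (x(k := t))) (at t)"
        unfolding beta_weight_eq by (auto intro!: derivative_eq_intros simp: algebra_simps)
      from DERIV_mult'[OF deriv[of x t] this]
      show "(h has_real_derivative F (x(k := t))) (at t)"
        unfolding h_def F_def by (simp add: algebra_simps)
    qed
  qed
  \<comment> \<open>Coordinate \<open>k\<close> is split off as the inner integral, which vanishes
    on every line.\<close>
  then have "integral\<^sup>L (PiM (insert k ({..<n} - {k})) (\<lambda>_. lborel)) F = 0"
    using int k by (subst product_integral_insert) (auto simp: insert_absorb intro!: integral_eq_zero_AE)
  then show "integral\<^sup>L ?M F = 0" using k by (simp add: insert_absorb)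
qed

section \<open>Loop equations of the beta ensemble\<close>

lemma sum_sum_mset_swap:
  fixes f :: "'a \<Rightarrow> 'b \<Rightarrow> real"
  shows "(\<Sum>i\<in>I. \<Sum>l\<in>#L. f i l) = (\<Sum>l\<in>#L. \<Sum>i\<in>I. f i l)"
  by (induction L) (simp_all add: sum.distrib)

definition power_mean :: "nat \<Rightarrow> real \<Rightarrow> nat \<Rightarrow> (nat \<Rightarrow> real) \<Rightarrow> real" where
  "power_mean n \<beta> l x = (\<Sum>i<n. (x i / (2 * sqrt (real n * \<beta>))) ^ l) / real n"

definition power_means :: "nat \<Rightarrow> real \<Rightarrow> nat multiset \<Rightarrow> (nat \<Rightarrow> real) \<Rightarrow> real" where
  "power_means n \<beta> L x = (\<Prod>l\<in>#L. power_mean n \<beta> l x)"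

text \<open>Left unnormalised: the loop equations are linear in it, so that a nonzero total mass
  matters only for the final division.\<close>

definition weighted_integral :: "nat \<Rightarrow> real \<Rightarrow> ((nat \<Rightarrow> real) \<Rightarrow> real) \<Rightarrow> real" where
  "weighted_integral n \<beta> F = (LINT x|PiM {..<n} (\<lambda>_. lborel). F x * beta_weight n \<beta> x)"

lemma power_means_empty [simp]: "power_means n \<beta> {#} x = 1"
  by (simp add: power_means_def)

lemma power_means_add [simp]:
  "power_means n \<beta> (add_mset l L) x = power_mean n \<beta> l x * power_means n \<beta> L x"
  by (simp add: power_means_def)

lemma poly_bounded_power_means: "poly_bounded n (power_means n \<beta> L)"
  unfolding power_means_def power_mean_def
  by (intro poly_bounded_prod_mset poly_bounded_divide_const poly_bounded_sum poly_bounded_power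
      poly_bounded_component) auto

lemma measurable_power_mean [measurable]:
  "power_mean n \<beta> l \<in> borel_measurable (PiM {..<n} (\<lambda>_. lborel))"
  unfolding power_mean_def
  by (intro borel_measurable_divide borel_measurable_sum borel_measurable_power borel_measurable_const
      component_measurable) auto

lemma measurable_power_means [measurable]:
  "power_means n \<beta> L \<in> borel_measurable (PiM {..<n} (\<lambda>_. lborel))"
proof (induction L)
  case (add l L)
  then have "(\<lambda>x. power_mean n \<beta> l x * power_means n \<beta> L x) \<in> borel_measurable (PiM {..<n} (\<lambda>_. lborel))"
    by (intro borel_measurable_times measurable_power_mean)
  then show ?case by (simp add: power_means_def)
qed (simp add: power_means_def)

lemma integrable_weighted:
  assumes "\<beta> \<ge> 1" "poly_bounded n f" "f \<in> borel_measurable (PiM {..<n} (\<lambda>_. lborel))"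
  shows "integrable (PiM {..<n} (\<lambda>_. lborel)) (\<lambda>x. f x * beta_weight n \<beta> x)"
  using integrable_poly_bounded[of n "\<lambda>x. f x * repulsion n \<beta> x"] assms
  by (simp add: beta_weight_eq mult.assoc poly_bounded_mult poly_bounded_repulsion)

lemma has_derivative_scaled_power:
  "((\<lambda>t. (t / c) ^ l) has_real_derivative real l * (t / c) ^ (l - 1) / c) (at t)" for c t :: real
  using DERIV_power[OF DERIV_cdivide[OF DERIV_ident]] by (simp add: mult_ac)

lemma has_derivative_power_mean:
  assumes "i < n"
  shows "((\<lambda>t. power_mean n \<beta> l (x(i := t))) has_real_derivative
    real l * (t / (2 * sqrt (real n * \<beta>))) ^ (l - 1) / (2 * sqrt (real n * \<beta>)) / real n) (at t)"
proof -
  let ?s = "2 * sqrt (real n * \<beta>)"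
  have "power_mean n \<beta> l (x(i := t)) = ((t / ?s) ^ l + (\<Sum>j\<in>{..<n} - {i}. (x j / ?s) ^ l)) / real n" for t
    unfolding power_mean_def using assms by (subst sum.remove[of _ i]) auto
  then show ?thesis
    using DERIV_cdivide[OF DERIV_add[OF has_derivative_scaled_power DERIV_const]]
    by (simp only: add_0_right)
qed

text \<open>The test functions are \<open>(x i / s) ^ k * power_means n \<beta> L x\<close>, summed
  over \<open>i\<close>. The force, antisymmetric in each pair, turns the k-th powers into divided
  differences, which split into products of lower power sums. Differentiating the other means gives
  the merging terms, and the Gaussian gives the power \<open>Suc k\<close>.\<close>

lemma loop_equation:
  assumes n: "n \<ge> 1" and \<beta>: "\<beta> \<ge> 1"
  defines "I \<equiv> \<lambda>L. weighted_integral n \<beta> (power_means n \<beta> L)"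
  shows "4 * I (add_mset (Suc k) L) =
      (\<Sum>a<k. I (add_mset a (add_mset (k - 1 - a) L))) +
      (2 / \<beta> - 1) * real k / real n * I (add_mset (k - 1) L) +
      2 / \<beta> / (real n)\<^sup>2 * (\<Sum>l\<in>#L. real l * I (add_mset (k + l - 1) (L - {#l#})))"
proof -
  let ?M = "PiM {..<n} (\<lambda>_. lborel :: real measure)"
  let ?P = "power_means n \<beta>" and ?w = "beta_weight n \<beta>"
  define s where "s = 2 * sqrt (real n * \<beta>)"
  have s: "s > 0" "s\<^sup>2 = 4 * real n * \<beta>" using n \<beta> by (simp_all add: s_def power_mult_distrib)
  have tau: "power_mean n \<beta> l x = (\<Sum>i<n. (x i / s) ^ l) / real n" for l x
    by (simp add: power_mean_def s_def)
  have tau_sum: "(\<Sum>i<n. (x i / s) ^ l) = real n * power_mean n \<beta> l x" for l x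
    using n by (simp add: tau)
  define f where "f i x = (x i / s) ^ k * ?P L x" for i x
  define f' where "f' i x = real k * (x i / s) ^ (k - 1) / s * ?P L x +
    (x i / s) ^ k * (\<Sum>l\<in>#L. real l * (x i / s) ^ (l - 1) / s / real n * ?P (L - {#l#}) x)" for i x
  define F where "F i x = (f' i x + f i x * (\<Sum>p\<in>index_pairs n. log_force \<beta> i p x) - f i x * x i / 2) * ?w x" for i x
  have F: "integrable ?M (F i)" "integral\<^sup>L ?M (F i) = 0" if i: "i < n" for i
  proof -
    have "poly_bounded n (f i)" unfolding f_def
      by (intro poly_bounded_mult poly_bounded_power poly_bounded_divide_const poly_bounded_component
          poly_bounded_power_means i)
    moreover have "poly_bounded n (f' i)" unfolding f'_def
      by (intro poly_bounded_mult poly_bounded_add poly_bounded_sum_mset poly_bounded_power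
          poly_bounded_divide_const poly_bounded_component poly_bounded_power_means poly_bounded_const i)
    moreover have "f i \<in> borel_measurable ?M" unfolding f_def
      by (intro borel_measurable_times borel_measurable_power borel_measurable_divide
          component_measurable measurable_power_means borel_measurable_const i)
    moreover have "f' i \<in> borel_measurable ?M"
    proof -
      have "(\<lambda>x. \<Sum>l\<in>#L. real l * (x i / s) ^ (l - 1) / s / real n * ?P (M l) x) \<in> borel_measurable ?M" for M
        by (induction L) (auto intro!: borel_measurable_add borel_measurable_times borel_measurable_power borel_measurable_divide
          component_measurable measurable_power_means borel_measurable_const i)
      then show ?thesis unfolding f'_def
        by (intro borel_measurable_add borel_measurable_times borel_measurable_power borel_measurable_divide
          component_measurable measurable_power_means borel_measurable_const i)
    qed
    moreover have "((\<lambda>t. f i (x(i := t))) has_real_derivative f' i (x(i := t))) (at t)" for x t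
    proof -
      have "((\<lambda>t. ?P L (x(i := t))) has_real_derivative
          (\<Sum>l\<in>#L. real l * (t / s) ^ (l - 1) / s / real n * ?P (L - {#l#}) (x(i := t)))) (at t)"
        unfolding power_means_def s_def
        by (intro has_derivative_prod_mset has_derivative_power_mean i)
      from DERIV_mult'[OF has_derivative_scaled_power[where c = s and l = k] this] show ?thesis
        unfolding f_def f'_def by (simp only: fun_upd_same add.commute)
    qed
    ultimately show "integrable ?M (F i)" "integral\<^sup>L ?M (F i) = 0"
      using integral_by_parts_beta_weight[OF \<beta> i, of "f i" "f' i"] unfolding F_def by blast+
  qed
  define G where "G x = (\<Sum>a<k. ?P (add_mset a (add_mset (k - 1 - a) L)) x) +
      (2 / \<beta> - 1) * real k / real n * ?P (add_mset (k - 1) L) x +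
      2 / \<beta> / (real n)\<^sup>2 * (\<Sum>l\<in>#L. real l * ?P (add_mset (k + l - 1) (L - {#l#})) x) -
      4 * ?P (add_mset (Suc k) L) x" for x
  have key: "(\<Sum>i<n. F i x) = \<beta> * (real n)\<^sup>2 / (2 * s) * (G x * ?w x)" for x
  proof (cases "?w x = 0")
    case False
    \<comment> \<open>At a collision \<open>0 powr \<beta>\<close> makes the weight vanish and both
      sides of \<open>key\<close> are 0, so differences of coordinates may be divided by in the
      remaining case.\<close>
    have distinct: "x i \<noteq> x j" if "(j, i) \<in> index_pairs n" for i j
    proof
      assume "x i = x j"
      then have "repulsion n \<beta> x = 0"
        unfolding repulsion_def using that by (intro prod_zero) (auto intro!: bexI[of _ "(j, i)"])
      then show False using False by (simp add: beta_weight_eq)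
    qed
    let ?t = "\<lambda>l. power_mean n \<beta> l x"
    have A: "(\<Sum>i<n. f' i x) = real n / s * real k * ?t (k - 1) * ?P L x +
        1 / s * (\<Sum>l\<in>#L. real l * ?P (add_mset (k + l - 1) (L - {#l#})) x)"
    proof -
      have "(\<Sum>i<n. real k * (x i / s) ^ (k - 1) / s * ?P L x) = real k / s * ?P L x * (\<Sum>i<n. (x i / s) ^ (k - 1))"
        unfolding sum_distrib_left by (intro sum.cong refl) simp
      moreover have "(\<Sum>i<n. (x i / s) ^ k * (\<Sum>l\<in>#L. real l * (x i / s) ^ (l - 1) / s / real n * ?P (L - {#l#}) x)) =
          (\<Sum>l\<in>#L. \<Sum>i<n. (x i / s) ^ k * (real l * (x i / s) ^ (l - 1) / s / real n * ?P (L - {#l#}) x))"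
        by (simp only: sum_mset_distrib_left image_mset.compositionality comp_def sum_sum_mset_swap)
      moreover have "\<dots> = (\<Sum>l\<in>#L. 1 / s * (real l * ?P (add_mset (k + l - 1) (L - {#l#})) x))"
      proof (intro arg_cong[where f = sum_mset] image_mset_cong)
        fix l assume "l \<in># L"
        show "(\<Sum>i<n. (x i / s) ^ k * (real l * (x i / s) ^ (l - 1) / s / real n * ?P (L - {#l#}) x)) =
            1 / s * (real l * ?P (add_mset (k + l - 1) (L - {#l#})) x)"
        proof (cases l)
          case (Suc m)
          have "(\<Sum>i<n. (x i / s) ^ k * (real l * (x i / s) ^ (l - 1) / s / real n * ?P (L - {#l#}) x)) =
              real l / s / real n * ?P (L - {#l#}) x * (\<Sum>i<n. (x i / s) ^ (k + l - 1))"
            unfolding sum_distrib_left by (intro sum.cong refl) (simp add: Suc power_add)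
          then show ?thesis using n by (simp add: tau_sum)
        qed simp
      qed
      ultimately show ?thesis
        by (simp add: f'_def sum.distrib tau_sum sum_mset_distrib_left image_mset.compositionality comp_def)
    qed
    have B: "(\<Sum>i<n. f i x * (\<Sum>p\<in>index_pairs n. log_force \<beta> i p x)) =
        \<beta> / (2 * s) * ((real n)\<^sup>2 * (\<Sum>a<k. ?t a * ?t (k - 1 - a)) - real k * (real n * ?t (k - 1))) * ?P L x"
    proof -
      \<comment> \<open>The divided difference of the k-th power at \<open>x a / s\<close> and
        \<open>x b / s\<close>, written as a polynomial so that it also makes sense for
        \<open>a = b\<close>.\<close>
      define S where "S a b = (\<Sum>q<k. (x a / s) ^ q * (x b / s) ^ (k - 1 - q))" for a b
      have S_sym: "S a b = S b a" for a b
        unfolding S_def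
        by (rule sum.reindex_bij_witness[of _ "\<lambda>q. k - 1 - q" "\<lambda>q. k - 1 - q"]) auto
      have "(\<Sum>i<n. f i x * (\<Sum>p\<in>index_pairs n. log_force \<beta> i p x)) =
          ?P L x * (\<Sum>p\<in>index_pairs n. \<Sum>i<n. (x i / s) ^ k * log_force \<beta> i p x)"
        by (subst sum.swap) (simp add: f_def sum_distrib_left mult_ac)
      also have "(\<Sum>p\<in>index_pairs n. \<Sum>i<n. (x i / s) ^ k * log_force \<beta> i p x) =
          (\<Sum>(j, i)\<in>index_pairs n. \<beta> / s * S i j)"
      proof (intro sum.cong refl)
        fix p assume p: "p \<in> index_pairs n"
        obtain b a where ab: "p = (b, a)" by (cases p)
        have lt: "a < n" "b < n" using p ab index_pairsD[of b a n] by auto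
        have ne: "x a - x b \<noteq> 0" using distinct p ab by simp
        have "(\<Sum>i<n. (x i / s) ^ k * log_force \<beta> i p x) =
            \<beta> / (x a - x b) * ((\<Sum>i<n. (x i / s) ^ k * of_bool (i = a)) - (\<Sum>i<n. (x i / s) ^ k * of_bool (i = b)))"
        proof -
          have "(x i / s) ^ k * log_force \<beta> i p x =
              \<beta> / (x a - x b) * ((x i / s) ^ k * of_bool (i = a) - (x i / s) ^ k * of_bool (i = b))" for i
            by (simp add: log_force_def ab algebra_simps diff_divide_distrib)
          then show ?thesis by (simp only: sum_distrib_left[symmetric] sum_subtractf)
        qed
        also have "\<dots> = \<beta> / (x a - x b) * ((x a / s) ^ k - (x b / s) ^ k)"
          using lt by (simp add: of_bool_def if_distrib cong: if_cong)
        also have "(x a / s) ^ k - (x b / s) ^ k = (x a / s - x b / s) * S a b"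
          unfolding S_def power_diff_sumr2 by (simp add: mult.commute)
        also have "\<beta> / (x a - x b) * ((x a / s - x b / s) * S a b) = \<beta> / s * S a b"
          using ne by (simp flip: diff_divide_distrib)
        finally show "(\<Sum>i<n. (x i / s) ^ k * log_force \<beta> i p x) = (case p of (j, i) \<Rightarrow> \<beta> / s * S i j)"
          by (simp add: ab)
      qed
      also have "\<dots> = \<beta> / (2 * s) * (2 * (\<Sum>(j, i)\<in>index_pairs n. S i j))"
        by (simp add: sum_distrib_left split_beta)
      \<comment> \<open>The full double sum gives the splitting term. The diagonal gives the -1 in
        \<open>2 / \<beta> - 1\<close>, whose other part comes from differentiating
        \<open>(x i / s) ^ k\<close> itself.\<close>
      also have "2 * (\<Sum>(j, i)\<in>index_pairs n. S i j) = (\<Sum>i<n. \<Sum>j<n. S i j) - (\<Sum>i<n. S i i)"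
        by (rule sum_index_pairs) (rule S_sym)
      also have "(\<Sum>i<n. \<Sum>j<n. S i j) = (\<Sum>q<k. (\<Sum>i<n. (x i / s) ^ q) * (\<Sum>j<n. (x j / s) ^ (k - 1 - q)))"
      proof -
        have "(\<Sum>i<n. \<Sum>j<n. S i j) = (\<Sum>i<n. \<Sum>q<k. \<Sum>j<n. (x i / s) ^ q * (x j / s) ^ (k - 1 - q))"
          unfolding S_def by (intro sum.cong refl sum.swap)
        also have "\<dots> = (\<Sum>q<k. \<Sum>i<n. \<Sum>j<n. (x i / s) ^ q * (x j / s) ^ (k - 1 - q))"
          by (rule sum.swap)
        finally show ?thesis by (simp only: sum_product)
      qed
      also have "\<dots> = (real n)\<^sup>2 * (\<Sum>a<k. ?t a * ?t (k - 1 - a))"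
        by (simp add: tau_sum sum_distrib_left power2_eq_square mult_ac)
      also have "(\<Sum>i<n. S i i) = real k * (\<Sum>i<n. (x i / s) ^ (k - 1))"
        unfolding S_def by (simp add: sum_distrib_left flip: power_add)
      finally show ?thesis by (simp add: tau_sum mult_ac)
    qed
    have C: "(\<Sum>i<n. f i x * x i / 2) = s * real n / 2 * ?t (Suc k) * ?P L x"
    proof -
      have "(\<Sum>i<n. f i x * x i / 2) = s / 2 * ?P L x * (\<Sum>i<n. (x i / s) ^ Suc k)"
        unfolding sum_distrib_left using s(1) by (intro sum.cong refl) (simp add: f_def)
      then show ?thesis by (simp only: tau_sum) simp
    qed
    define D where "D = (\<Sum>l\<in>#L. real l * ?P (add_mset (k + l - 1) (L - {#l#})) x)"
    define Q where "Q = (\<Sum>a<k. ?t a * ?t (k - 1 - a))"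
    have "(\<Sum>i<n. F i x) = ((\<Sum>i<n. f' i x) + (\<Sum>i<n. f i x * (\<Sum>p\<in>index_pairs n. log_force \<beta> i p x)) -
        (\<Sum>i<n. f i x * x i / 2)) * ?w x"
      by (simp add: F_def sum_distrib_right sum.distrib sum_subtractf left_diff_distrib distrib_right)
    also have "\<dots> = (real n / s * real k * ?t (k - 1) * ?P L x + 1 / s * D +
        \<beta> / (2 * s) * ((real n)\<^sup>2 * Q - real k * (real n * ?t (k - 1))) * ?P L x -
        s * real n / 2 * ?t (Suc k) * ?P L x) * ?w x"
      by (simp only: A B C D_def Q_def)
    also have "\<dots> = \<beta> * (real n)\<^sup>2 / (2 * s) * (Q * ?P L x + (2 / \<beta> - 1) * real k / real n * (?t (k - 1) * ?P L x) +
        2 / \<beta> / (real n)\<^sup>2 * D - 4 * (?t (Suc k) * ?P L x)) * ?w x"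
    proof -
      \<comment> \<open>Since \<open>s\<^sup>2 = 4 * n * \<beta>\<close>, the scaling makes the
        coefficient of the power \<open>Suc k\<close> equal to 4, the constant of the recursion for
        \<open>scat\<close>.\<close>
      have s2: "s * real n / 2 = \<beta> * (real n)\<^sup>2 / (2 * s) * 4"
        using s by (simp add: field_simps power2_eq_square)
      show ?thesis unfolding s2 using s(1) n \<beta>
        by (simp add: field_simps power2_eq_square)
    qed
    also have "\<dots> = \<beta> * (real n)\<^sup>2 / (2 * s) * (G x * ?w x)"
    proof -
      have "(\<Sum>a<k. ?t a * (?t (k - 1 - a) * ?P L x)) = Q * ?P L x"
        by (simp only: Q_def sum_distrib_right mult.assoc)
      then show ?thesis by (simp only: G_def D_def power_means_add mult.assoc)
    qed
    finally show ?thesis .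
  qed (simp add: F_def)
  have "0 = (\<Sum>i<n. integral\<^sup>L ?M (F i))" using F by simp
  also have "\<dots> = integral\<^sup>L ?M (\<lambda>x. \<Sum>i<n. F i x)" using F by (intro Bochner_Integration.integral_sum[symmetric]) auto
  also have "\<dots> = \<beta> * (real n)\<^sup>2 / (2 * s) * weighted_integral n \<beta> G"
    by (simp add: key weighted_integral_def)
  finally have 0: "weighted_integral n \<beta> G = 0" using \<beta> n s(1) by simp
  \<comment> \<open>This form carries integrability and value together through the finite sums and
    the multiset sum.\<close>
  have hbi: "has_bochner_integral ?M (\<lambda>x. ?P M x * ?w x) (I M)" for M
    unfolding I_def weighted_integral_def
    by (intro has_bochner_integral_integrable integrable_weighted \<beta> poly_bounded_power_means measurable_power_means)
  have hbi_mset: "has_bochner_integral ?M (\<lambda>x. \<Sum>l\<in>#N. real l * (?P (M l) x * ?w x)) (\<Sum>l\<in>#N. real l * I (M l))" for M N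
    by (induction N) (auto intro!: has_bochner_integral_add has_bochner_integral_mult_right hbi)
  have "weighted_integral n \<beta> G = integral\<^sup>L ?M (\<lambda>x. 
      (\<Sum>a<k. ?P (add_mset a (add_mset (k - 1 - a) L)) x * ?w x) +
      (2 / \<beta> - 1) * real k / real n * (?P (add_mset (k - 1) L) x * ?w x) +
      2 / \<beta> / (real n)\<^sup>2 * (\<Sum>l\<in>#L. real l * (?P (add_mset (k + l - 1) (L - {#l#})) x * ?w x)) -
      4 * (?P (add_mset (Suc k) L) x * ?w x))"
    unfolding weighted_integral_def G_def
    by (intro Bochner_Integration.integral_cong refl)
      (simp only: left_diff_distrib distrib_right sum_distrib_right sum_mset_distrib_right mult.assoc
        image_mset.compositionality comp_def)
  also have "\<dots> = (\<Sum>a<k. I (add_mset a (add_mset (k - 1 - a) L))) +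
      (2 / \<beta> - 1) * real k / real n * I (add_mset (k - 1) L) +
      2 / \<beta> / (real n)\<^sup>2 * (\<Sum>l\<in>#L. real l * I (add_mset (k + l - 1) (L - {#l#}))) -
      4 * I (add_mset (Suc k) L)"
    by (intro has_bochner_integral_integral_eq has_bochner_integral_diff has_bochner_integral_add
        has_bochner_integral_mult_right has_bochner_integral_sum hbi hbi_mset)
  finally show ?thesis using 0 by simp
qed

lemma loop_recursion_beta_ensemble:
  assumes n: "n \<ge> 1" and \<beta>: "\<beta> \<ge> 1" and Z: "weighted_integral n \<beta> (\<lambda>_. 1) \<noteq> 0"
  shows "loop_recursion (\<lambda>L. weighted_integral n \<beta> (power_means n \<beta> L) / weighted_integral n \<beta> (\<lambda>_. 1)) (real n) (2 / \<beta>)"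
proof
  let ?Z = "weighted_integral n \<beta> (\<lambda>_. 1)"
  have e: "power_means n \<beta> {#} = (\<lambda>_. 1)" "power_means n \<beta> (add_mset 0 L) = power_means n \<beta> L" for L
    using n by (auto simp: power_mean_def)
  show "weighted_integral n \<beta> (power_means n \<beta> {#}) / ?Z = 1" using Z by (simp only: e) simp
  show "weighted_integral n \<beta> (power_means n \<beta> (add_mset 0 L)) / ?Z = weighted_integral n \<beta> (power_means n \<beta> L) / ?Z" for L
    by (simp only: e)
  fix k L
  let ?I = "\<lambda>L. weighted_integral n \<beta> (power_means n \<beta> L)"
  have "4 * (?I (add_mset (Suc k) L) / ?Z) = (4 * ?I (add_mset (Suc k) L)) / ?Z" by simp
  also have "\<dots> = (\<Sum>a<k. ?I (add_mset a (add_mset (k - 1 - a) L)) / ?Z) +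
      (2 / \<beta> - 1) * real k / real n * (?I (add_mset (k - 1) L) / ?Z) +
      2 / \<beta> / (real n)\<^sup>2 * ((\<Sum>l\<in>#L. real l * ?I (add_mset (k + l - 1) (L - {#l#}))) / ?Z)"
    unfolding loop_equation[OF n \<beta>] by (simp add: add_divide_distrib sum_divide_distrib)
  also have "(\<Sum>l\<in>#L. real l * ?I (add_mset (k + l - 1) (L - {#l#}))) / ?Z =
      (\<Sum>l\<in>#L. real l * (?I (add_mset (k + l - 1) (L - {#l#})) / ?Z))"
    by (simp add: divide_inverse sum_mset_distrib_right image_mset.compositionality comp_def mult.assoc)
  finally show "4 * (?I (add_mset (Suc k) L) / ?Z) = (\<Sum>a<k. ?I (add_mset a (add_mset (k - 1 - a) L)) / ?Z) +
      (2 / \<beta> - 1) * real k / real n * (?I (add_mset (k - 1) L) / ?Z) +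
      2 / \<beta> / (real n)\<^sup>2 * (\<Sum>l\<in>#L. real l * (?I (add_mset (k + l - 1) (L - {#l#})) / ?Z))" .
qed (use n \<beta> in \<open>auto simp: divide_le_eq\<close>)

section \<open>Expected traces\<close>

text \<open>The binomial asymptotics at -1/2 and Gamma(1/2) = sqrt pi give that
  \<open>cbin j\<close> is asymptotic to 1 / sqrt (pi j); the denominator \<open>j + 1\<close> of
  \<open>scat\<close> supplies the remaining power.\<close>

lemma scat_asymptotic: "(\<lambda>j. scat j * (sqrt pi * (real j * sqrt (real j)))) \<longlonglongrightarrow> 1"
proof -
  have "(\<lambda>j. ((- 1/2 :: real) gchoose j) / ((-1) ^ j / exp ((- 1/2 + 1) * of_real (ln (real j))))) \<longlonglongrightarrow> inverse (Gamma (- (- 1/2 :: real)))"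
    by (rule gbinomial_asymptotic)
  moreover have "\<forall>\<^sub>F j in sequentially. ((- 1/2 :: real) gchoose j) / ((-1) ^ j / exp ((- 1/2 + 1) * of_real (ln (real j)))) =
      cbin j * sqrt (real j)"
    using eventually_gt_at_top[of 0]
  proof eventually_elim
    case (elim j)
    have "exp ((- 1/2 + 1) * ln (real j)) = sqrt (real j)"
      using elim by (simp add: powr_half_sqrt[symmetric] powr_def)
    moreover have "a / ((-1) ^ j / b) = (-1) ^ j * a * b" for a b :: real
      by (cases "even j") auto
    ultimately show ?case by (simp only: of_real_eq_id id_apply cbin_def)
  qed
  ultimately have "(\<lambda>j. cbin j * sqrt (real j)) \<longlonglongrightarrow> inverse (sqrt pi)"
    using Lim_transform_eventually by (fastforce simp: Gamma_one_half_real)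
  moreover have "(\<lambda>j. real j / (real j + 1)) \<longlonglongrightarrow> 1" by real_asymp
  ultimately have "(\<lambda>j. (cbin j * sqrt (real j)) * (real j / (real j + 1)) * sqrt pi) \<longlonglongrightarrow> inverse (sqrt pi) * 1 * sqrt pi"
    by (intro tendsto_mult tendsto_const)
  then show ?thesis by (simp add: scat_def mult_ac)
qed

lemma harm_le_ln: "m \<ge> 1 \<Longrightarrow> harm m \<le> 1 + ln (real m)"
proof (induction m rule: nat_induct_at_least)
  case (Suc m)
  have "ln (real m / real (Suc m)) \<le> real m / real (Suc m) - 1"
    using Suc by (intro ln_le_minus_one) auto
  then have "inverse (real (Suc m)) \<le> ln (real (Suc m)) - ln (real m)"
    using Suc by (simp add: ln_div field_simps)
  then show ?case using Suc by (simp add: harm_Suc)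
qed (simp add: harm_def)

text \<open>The moment bound costs a squared logarithm beyond p^(3/2) / n, and the margin \<epsilon>
  in the exponent pays for it.\<close>

lemma tendsto_size_condition:
  fixes p :: "nat \<Rightarrow> nat" and \<epsilon> :: real
  assumes p: "filterlim p at_top sequentially" and \<epsilon>: "\<epsilon> > 0"
    and bigo: "(\<lambda>n. real (p n)) \<in> O(\<lambda>n. real n powr (2 / 3 - \<epsilon>))"
  shows "(\<lambda>n. real (p n) * sqrt (real (p n)) * (1 + harm (p n))\<^sup>2 / real n) \<longlonglongrightarrow> 0"
proof -
  define g where "g m = (1 + harm m)\<^sup>2 / real m powr \<epsilon>" for m :: nat
  have "(\<lambda>m. (2 + ln (real m))\<^sup>2 / real m powr \<epsilon>) \<longlonglongrightarrow> 0" using \<epsilon> by real_asymp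
  moreover have "\<forall>\<^sub>F m in sequentially. norm (g m) \<le> (2 + ln (real m))\<^sup>2 / real m powr \<epsilon>"
    using eventually_ge_at_top[of 1]
  proof eventually_elim
    case (elim m)
    have "(1 + harm m)\<^sup>2 \<le> (2 + ln (real m))\<^sup>2"
      using harm_le_ln[OF elim] harm_nonneg[of m, where 'a = real] by (intro power_mono) auto
    then show ?case by (auto simp: g_def intro!: divide_right_mono)
  qed
  ultimately have "g \<longlonglongrightarrow> 0" by (rule Lim_null_comparison[rotated])
  then have gp: "(\<lambda>n. g (p n)) \<longlonglongrightarrow> 0" by (rule filterlim_compose[OF _ p])
  obtain K where K: "K > 0" "\<forall>\<^sub>F n in sequentially. norm (real (p n)) \<le> K * norm (real n powr (2 / 3 - \<epsilon>))"
    using landau_o.bigE[OF bigo] by blast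
  define K' where "K' = K powr (3 / 2 + \<epsilon>)"
  have "(\<lambda>n. K' * g (p n)) \<longlonglongrightarrow> 0" using tendsto_mult[OF tendsto_const gp, of K'] by simp
  moreover have "\<forall>\<^sub>F n in sequentially. norm (real (p n) * sqrt (real (p n)) * (1 + harm (p n))\<^sup>2 / real n) \<le> K' * g (p n)"
    using K(2) eventually_ge_at_top[of 1] filterlim_at_top[THEN iffD1, OF p, rule_format, of 1]
  proof eventually_elim
    case (elim n)
    \<comment> \<open>The product is 1 - 5\<epsilon>/6 - \<epsilon>^2. Raising the growth bound to
      the power 3/2 + \<epsilon> rather than 3/2 leaves a spare factor
      \<open>p n powr \<epsilon>\<close>, against which the logarithm in \<open>g\<close> is
      negligible.\<close>
    have e: "(2 / 3 - \<epsilon>) * (3 / 2 + \<epsilon>) \<le> 1"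
      using \<epsilon> zero_le_power2[of \<epsilon>] by (simp add: algebra_simps power2_eq_square)
    have "real (p n) powr (3 / 2 + \<epsilon>) \<le> (K * real n powr (2 / 3 - \<epsilon>)) powr (3 / 2 + \<epsilon>)"
      using elim \<epsilon> by (intro powr_mono2) auto
    also have "\<dots> = K' * real n powr ((2 / 3 - \<epsilon>) * (3 / 2 + \<epsilon>))"
      using K(1) by (simp add: powr_mult powr_powr K'_def)
    also have "\<dots> \<le> K' * real n powr 1"
      using elim e by (intro mult_left_mono powr_mono) (auto simp: K'_def)
    finally have le: "real (p n) powr (3 / 2 + \<epsilon>) \<le> K' * real n" using elim by simp
    have "real (p n) * sqrt (real (p n)) = real (p n) powr (1 + 1 / 2)"
      using elim by (simp only: powr_add) (simp add: powr_half_sqrt)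
    also have "\<dots> = real (p n) powr (3 / 2 + \<epsilon>) / real (p n) powr \<epsilon>"
      using elim by (simp add: powr_add)
    finally have e2: "real (p n) * sqrt (real (p n)) = real (p n) powr (3 / 2 + \<epsilon>) / real (p n) powr \<epsilon>" .
    have "norm (real (p n) * sqrt (real (p n)) * (1 + harm (p n))\<^sup>2 / real n) =
        real (p n) powr (3 / 2 + \<epsilon>) * (g (p n) / real n)"
      unfolding e2 g_def by (simp add: abs_mult)
    also have "\<dots> \<le> K' * real n * (g (p n) / real n)"
      using le by (intro mult_right_mono) (auto simp: g_def)
    also have "\<dots> = K' * g (p n)" using elim by simp
    finally show ?case .
  qed
  ultimately show ?thesis by (rule Lim_null_comparison[rotated])
qed

section \<open>From random matrices to integrals over the ensemble\<close>

lemma measurable_mat_pow_entry: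
  assumes "random_matrix M n A" "i < n" "j < n"
  shows "(\<lambda>\<omega>. (A \<omega> ^\<^sub>m k) $$ (i, j)) \<in> borel_measurable M"
  using assms(2,3)
proof (induction k arbitrary: i j)
  case 0
  have "(\<lambda>\<omega>. (A \<omega> ^\<^sub>m 0) $$ (i, j)) \<in> borel_measurable M \<longleftrightarrow> (\<lambda>\<omega>. if i = j then 1 else 0 :: complex) \<in> borel_measurable M"
    using assms(1) 0 by (intro measurable_cong) (auto simp: random_matrix_def)
  then show ?case by simp
next
  case (Suc k)
  have "(A \<omega> ^\<^sub>m Suc k) $$ (i, j) = (\<Sum>l<n. (A \<omega> ^\<^sub>m k) $$ (i, l) * A \<omega> $$ (l, j))" if "\<omega> \<in> space M" for \<omega>
  proof -
    have "A \<omega> \<in> carrier_mat n n" using assms(1) that by (auto simp: random_matrix_def)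
    then show ?thesis using Suc.prems by (simp add: scalar_prod_def atLeast0LessThan)
  qed
  then have "(\<lambda>\<omega>. (A \<omega> ^\<^sub>m Suc k) $$ (i, j)) \<in> borel_measurable M \<longleftrightarrow>
      (\<lambda>\<omega>. \<Sum>l<n. (A \<omega> ^\<^sub>m k) $$ (i, l) * A \<omega> $$ (l, j)) \<in> borel_measurable M"
    by (intro measurable_cong)
  moreover have "(\<lambda>\<omega>. \<Sum>l<n. (A \<omega> ^\<^sub>m k) $$ (i, l) * A \<omega> $$ (l, j)) \<in> borel_measurable M"
    using assms(1) Suc by (intro borel_measurable_sum borel_measurable_times) (auto simp: random_matrix_def)
  ultimately show ?case by blast
qed

text \<open>The trace equals a power sum of eigenvalues only almost everywhere, and completeness of
  \<open>M\<close> is not assumed, so measurability has to come from the matrix entries.\<close>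

lemma measurable_mat_trace_pow:
  assumes "random_matrix M n A"
  shows "(\<lambda>\<omega>. mat_trace (A \<omega> ^\<^sub>m k)) \<in> borel_measurable M"
proof -
  have "(\<lambda>\<omega>. mat_trace (A \<omega> ^\<^sub>m k)) \<in> borel_measurable M \<longleftrightarrow>
      (\<lambda>\<omega>. \<Sum>i<n. (A \<omega> ^\<^sub>m k) $$ (i, i)) \<in> borel_measurable M"
    using assms by (intro measurable_cong) (auto simp: random_matrix_def mat_trace_def)
  moreover have "(\<lambda>\<omega>. \<Sum>i<n. (A \<omega> ^\<^sub>m k) $$ (i, i)) \<in> borel_measurable M"
    using measurable_mat_pow_entry[OF assms] by (intro borel_measurable_sum) auto
  ultimately show ?thesis by blast
qed

text \<open>Preimages under a symmetric \<open>f\<close> are permutation-invariant, so a law known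
  only on invariant sets determines the distribution of \<open>f\<close>.\<close>

lemma distr_symmetric_function:
  assumes x: "x \<in> measurable M (PiM {..<n} (\<lambda>_. borel))" and Q: "sets Q = sets (PiM {..<n} (\<lambda>_. borel))"
    and law: "\<And>B. B \<in> sets (PiM {..<n} (\<lambda>_. borel)) \<Longrightarrow> permutation_invariant n B \<Longrightarrow>
        emeasure M (x -` B \<inter> space M) = emeasure Q B"
    and f: "f \<in> measurable (PiM {..<n} (\<lambda>_. borel)) N"
    and sym: "\<And>y \<pi>. \<pi> permutes {..<n} \<Longrightarrow> f (y \<circ> \<pi>) = f y"
  shows "distr M N (\<lambda>\<omega>. f (x \<omega>)) = distr Q N f"
proof (rule measure_eqI)
  fix S assume "S \<in> sets (distr M N (\<lambda>\<omega>. f (x \<omega>)))"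
  then have S: "S \<in> sets N" by simp
  let ?P = "PiM {..<n} (\<lambda>_. borel :: real measure)"
  define B where "B = f -` S \<inter> space ?P"
  have B: "B \<in> sets ?P" unfolding B_def using f S by (rule measurable_sets)
  have "permutation_invariant n B"
    unfolding permutation_invariant_def
  proof (intro allI impI ballI)
    fix \<pi> y assume \<pi>: "\<pi> permutes {..<n}" and y: "y \<in> B"
    \<comment> \<open>\<pi> fixes the indices outside \<open>{..<n}\<close>, so
      \<open>y \<circ> \<pi>\<close> keeps the default value there and stays in the product
      space.\<close>
    have "(y \<circ> \<pi>) i = undefined" if "i \<notin> {..<n}" for i
      using y that \<pi> by (auto simp: B_def space_PiM PiE_def extensional_def permutes_not_in)
    then have "y \<circ> \<pi> \<in> space ?P" by (auto simp: space_PiM PiE_def extensional_def)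
    then show "y \<circ> \<pi> \<in> B" using y sym[OF \<pi>] by (simp add: B_def)
  qed
  have fQ: "f \<in> measurable Q N" using f by (simp add: measurable_cong_sets[OF Q refl])
  have fx: "(\<lambda>\<omega>. f (x \<omega>)) \<in> measurable M N" using x f by (rule measurable_compose)
  have "emeasure (distr M N (\<lambda>\<omega>. f (x \<omega>))) S = emeasure M ((\<lambda>\<omega>. f (x \<omega>)) -` S \<inter> space M)"
    using fx S by (rule emeasure_distr)
  also have "(\<lambda>\<omega>. f (x \<omega>)) -` S \<inter> space M = x -` B \<inter> space M"
    using measurable_space[OF x] by (auto simp: B_def)
  also have "emeasure M \<dots> = emeasure Q B" by (rule law) fact+
  also have "B = f -` S \<inter> space Q" using sets_eq_imp_space_eq[OF Q] by (simp add: B_def)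
  also have "emeasure Q \<dots> = emeasure (distr Q N f) S" using fQ S by (rule emeasure_distr[symmetric])
  finally show "emeasure (distr M N (\<lambda>\<omega>. f (x \<omega>))) S = emeasure (distr Q N f) S" .
qed simp

lemma beta_weight_nonneg: "beta_weight n \<beta> x \<ge> 0"
  by (simp add: beta_weight_def prod_nonneg)

lemma measurable_beta_weight [measurable]: "beta_weight n \<beta> \<in> borel_measurable (PiM {..<n} (\<lambda>_. lborel))"
proof -
  have "gaussian_factor n \<in> borel_measurable (PiM {..<n} (\<lambda>_. lborel))"
    unfolding gaussian_factor_def[abs_def] by measurable
  then show ?thesis unfolding beta_weight_eq[abs_def]
    by (intro borel_measurable_times repulsion_measurable)
qed

lemma expectation_mat_trace:
  assumes n: "n \<ge> 1" and \<beta>: "\<beta> \<ge> 1" and M: "prob_space M" and A: "random_matrix M n A"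
    and ev: "eigenvalues_have_law M n A (scaled_gaussian_beta_ensemble n \<beta>)"
  shows "weighted_integral n \<beta> (\<lambda>_. 1) \<noteq> 0"
    and "integrable M (\<lambda>\<omega>. mat_trace (A \<omega> ^\<^sub>m k))"
    and "integral\<^sup>L M (\<lambda>\<omega>. mat_trace (A \<omega> ^\<^sub>m k)) = complex_of_real
      (real n * (weighted_integral n \<beta> (power_means n \<beta> {#k#}) / weighted_integral n \<beta> (\<lambda>_. 1)))"
proof -
  interpret prob_space M by fact
  let ?L = "PiM {..<n} (\<lambda>_. lborel :: real measure)" and ?P = "PiM {..<n} (\<lambda>_. borel :: real measure)"
  let ?Q = "scaled_gaussian_beta_ensemble n \<beta>"
  define Z where "Z = weighted_integral n \<beta> (\<lambda>_. 1)"
  define sc where "sc x = (\<lambda>i\<in>{..<n}. x i / (2 * sqrt (real n * \<beta>)))" for x :: "nat \<Rightarrow> real"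
  define f where "f x = (\<Sum>i<n. x i ^ k)" for x :: "nat \<Rightarrow> real"
  define d where "d x = beta_normalization n \<beta> * beta_weight n \<beta> x" for x
  have norm: "beta_normalization n \<beta> = 1 / Z" by (simp add: beta_normalization_def Z_def weighted_integral_def)
  have Z_nonneg: "Z \<ge> 0" unfolding Z_def weighted_integral_def by (simp add: beta_weight_nonneg)
  have d_nonneg: "d x \<ge> 0" for x using Z_nonneg by (simp add: d_def norm beta_weight_nonneg)
  have d_meas [measurable]: "d \<in> borel_measurable ?L"
    unfolding d_def[abs_def] by (intro borel_measurable_times borel_measurable_const measurable_beta_weight)
  have gbe: "gaussian_beta_ensemble n \<beta> = density ?L (\<lambda>x. ennreal (d x))"
    by (simp add: gaussian_beta_ensemble_def d_def)
  have sc_meas: "sc \<in> measurable ?L ?P"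
    unfolding sc_def[abs_def]
    by (intro measurable_restrict borel_measurable_divide borel_measurable_const component_measurable) auto
  have sc_meas': "sc \<in> measurable (gaussian_beta_ensemble n \<beta>) ?P"
    using sc_meas by (simp add: gbe)
  have Q: "?Q = distr (gaussian_beta_ensemble n \<beta>) ?P sc"
    by (simp add: scaled_gaussian_beta_ensemble_def sc_def[abs_def])
  have sets_Q: "sets ?Q = sets ?P" by (simp add: Q)
  obtain x where x: "x \<in> measurable M ?P"
    and cp: "AE \<omega> in M. char_poly (A \<omega>) = (\<Prod>i<n. [:- complex_of_real (x \<omega> i), 1:])"
    and law: "\<And>B. B \<in> sets ?P \<Longrightarrow> permutation_invariant n B \<Longrightarrow> emeasure M (x -` B \<inter> space M) = emeasure ?Q B"
    using ev unfolding eigenvalues_have_law_def by blast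
  have f_meas: "f \<in> borel_measurable ?P"
    unfolding f_def[abs_def] by (intro borel_measurable_sum borel_measurable_power measurable_component_singleton) auto
  have sym: "f (y \<circ> \<pi>) = f y" if "\<pi> permutes {..<n}" for y \<pi>
    unfolding f_def using sum.permute[OF that, of "\<lambda>i. y i ^ k"] by (simp add: comp_def)
  have distr: "distr M borel (\<lambda>\<omega>. f (x \<omega>)) = distr ?Q borel f"
    by (rule distr_symmetric_function[OF x sets_Q law f_meas sym])
  have fx_meas: "(\<lambda>\<omega>. f (x \<omega>)) \<in> borel_measurable M" using x f_meas by (rule measurable_compose)
  \<comment> \<open>No lower bound on the integral is computed: if it were 0, then
    \<open>1 / 0 = 0\<close> would make the ensemble the null measure, while the law of
    \<open>f (x \<omega>)\<close> under the probability measure \<open>M\<close> has mass 1.\<close>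
  show Z: "weighted_integral n \<beta> (\<lambda>_. 1) \<noteq> 0"
  proof
    assume "weighted_integral n \<beta> (\<lambda>_. 1) = 0"
    then have "d x = 0" for x by (simp add: d_def norm Z_def)
    then have "emeasure (gaussian_beta_ensemble n \<beta>) B = 0" if "B \<in> sets ?L" for B
      using that by (simp add: gbe emeasure_density)
    moreover have "distr ?Q borel f = distr (gaussian_beta_ensemble n \<beta>) borel (f \<circ> sc)"
      unfolding Q using f_meas sc_meas' by (rule distr_distr)
    moreover have "emeasure (distr M borel (\<lambda>\<omega>. f (x \<omega>))) UNIV = 1"
      using fx_meas by (simp add: emeasure_distr emeasure_space_1)
    moreover have "f \<circ> sc \<in> borel_measurable ?L" using measurable_comp[OF sc_meas f_meas] .
    ultimately show False
      by (simp add: distr emeasure_distr gbe)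
  qed
  have f_sc: "f (sc y) = real n * power_means n \<beta> {#k#} y" for y
    using n by (simp add: f_def sc_def power_mean_def)
  have int_L: "integrable ?L (\<lambda>y. d y *\<^sub>R f (sc y))"
  proof -
    have "integrable ?L (\<lambda>y. (real n / Z) * (power_means n \<beta> {#k#} y * beta_weight n \<beta> y))"
      by (intro integrable_mult_right integrable_weighted \<beta> poly_bounded_power_means measurable_power_means)
    then show ?thesis by (simp add: d_def norm f_sc mult_ac)
  qed
  have fsc_meas: "(\<lambda>y. f (sc y)) \<in> borel_measurable ?L" using sc_meas f_meas by (rule measurable_compose)
  have int_Q: "integrable ?Q f"
    unfolding Q using integrable_distr_eq[OF sc_meas' f_meas] int_L d_nonneg fsc_meas
    by (simp add: gbe integrable_density)
  have "integral\<^sup>L ?Q f = (LINT y|?L. d y *\<^sub>R f (sc y))"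
    unfolding Q using integral_distr[OF sc_meas' f_meas] d_nonneg fsc_meas
    by (simp add: gbe integral_density)
  also have "\<dots> = (LINT y|?L. (real n / Z) * (power_means n \<beta> {#k#} y * beta_weight n \<beta> y))"
    by (intro Bochner_Integration.integral_cong refl) (simp add: d_def norm f_sc mult_ac)
  also have "\<dots> = real n * (weighted_integral n \<beta> (power_means n \<beta> {#k#}) / Z)"
    by (simp add: weighted_integral_def)
  finally have E_Q: "integral\<^sup>L ?Q f = real n * (weighted_integral n \<beta> (power_means n \<beta> {#k#}) / Z)" .
  have fQ_meas: "f \<in> borel_measurable ?Q" using f_meas by (simp add: measurable_cong_sets[OF sets_Q refl])
  \<comment> \<open>Integrability and mean pass from the ensemble to \<open>M\<close> through the
    identity on the common law of \<open>f\<close> on the line.\<close>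
  have "integrable (distr ?Q borel f) (\<lambda>t. t)" using int_Q fQ_meas by (simp add: integrable_distr_eq)
  then have int_M: "integrable M (\<lambda>\<omega>. f (x \<omega>))"
    using fx_meas by (simp add: distr[symmetric] integrable_distr_eq)
  have "integral\<^sup>L M (\<lambda>\<omega>. f (x \<omega>)) = integral\<^sup>L (distr M borel (\<lambda>\<omega>. f (x \<omega>))) (\<lambda>t. t)"
    using fx_meas by (simp add: integral_distr)
  also have "\<dots> = integral\<^sup>L ?Q f" unfolding distr using fQ_meas by (simp add: integral_distr)
  finally have E_M: "integral\<^sup>L M (\<lambda>\<omega>. f (x \<omega>)) = integral\<^sup>L ?Q f" .
  have tr: "AE \<omega> in M. complex_of_real (f (x \<omega>)) = mat_trace (A \<omega> ^\<^sub>m k)"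
    using cp AE_space
  proof eventually_elim
    case (elim \<omega>)
    have "A \<omega> \<in> carrier_mat n n" using A elim by (auto simp: random_matrix_def)
    from mat_trace_pow_eigenvalues[OF this elim(1), of k] show ?case by (simp add: f_def)
  qed
  have cf_meas: "(\<lambda>\<omega>. complex_of_real (f (x \<omega>))) \<in> borel_measurable M"
    by (rule measurable_compose[OF fx_meas]) (intro borel_measurable_continuous_onI continuous_intros)
  have tr_meas: "(\<lambda>\<omega>. mat_trace (A \<omega> ^\<^sub>m k)) \<in> borel_measurable M" by (rule measurable_mat_trace_pow[OF A])
  show "integrable M (\<lambda>\<omega>. mat_trace (A \<omega> ^\<^sub>m k))"
    using integrable_cong_AE[OF cf_meas tr_meas tr] int_M by (simp add: integrable_of_real)
  have "integral\<^sup>L M (\<lambda>\<omega>. mat_trace (A \<omega> ^\<^sub>m k)) = integral\<^sup>L M (\<lambda>\<omega>. complex_of_real (f (x \<omega>)))"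
    by (rule integral_cong_AE[OF cf_meas tr_meas tr, symmetric])
  also have "\<dots> = complex_of_real (integral\<^sup>L M (\<lambda>\<omega>. f (x \<omega>)))" by (rule integral_complex_of_real)
  finally show "integral\<^sup>L M (\<lambda>\<omega>. mat_trace (A \<omega> ^\<^sub>m k)) = complex_of_real
      (real n * (weighted_integral n \<beta> (power_means n \<beta> {#k#}) / weighted_integral n \<beta> (\<lambda>_. 1)))"
    by (simp add: E_M E_Q Z_def)
qed

theorem theorem2:
  fixes \<beta> \<epsilon> :: real
    and M :: "nat \<Rightarrow> 'a measure"
    and A :: "nat \<Rightarrow> 'a \<Rightarrow> complex mat"
    and p :: "nat \<Rightarrow> nat"
  assumes "\<beta> \<ge> 1"
    and "\<And>n. n \<ge> 1 \<Longrightarrow> prob_space (M n)"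
    and "\<And>n. n \<ge> 1 \<Longrightarrow> random_matrix (M n) n (A n)"
    and "\<And>n. n \<ge> 1 \<Longrightarrow>
           eigenvalues_have_law (M n) n (A n) (scaled_gaussian_beta_ensemble n \<beta>)"
    and "\<And>n. n \<ge> 1 \<Longrightarrow> p n > 0"
    and "filterlim p at_top sequentially"
    and "\<epsilon> > 0"
    and "(\<lambda>n. real (p n)) \<in> O(\<lambda>n. real n powr (2 / 3 - \<epsilon>))"
  shows "(\<forall>n\<ge>1. integrable (M n) (\<lambda>\<omega>. mat_trace (A n \<omega> ^\<^sub>m p n))) \<and>
         (\<exists>\<delta> :: nat \<Rightarrow> real. \<delta> \<in> o(\<lambda>_. 1) \<and>
           (\<forall>n\<ge>1. prob_space.expectation (M n) (\<lambda>\<omega>. mat_trace (A n \<omega> ^\<^sub>m p n)) =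
             (if even (p n)
              then complex_of_real
                     (2 powr (3/2) * real n * (pi * real (p n) ^ 3) powr (- (1/2)) * (1 + \<delta> n))
              else 0)))"
proof -
  define T where "T n L = weighted_integral n \<beta> (power_means n \<beta> L) / weighted_integral n \<beta> (\<lambda>_. 1)" for n L
  have tr: "weighted_integral n \<beta> (\<lambda>_. 1) \<noteq> 0"
    "integrable (M n) (\<lambda>\<omega>. mat_trace (A n \<omega> ^\<^sub>m p n))"
    "integral\<^sup>L (M n) (\<lambda>\<omega>. mat_trace (A n \<omega> ^\<^sub>m p n)) = complex_of_real (real n * T n {#p n#})"
    if "n \<ge> 1" for n
    using expectation_mat_trace(1)[OF that assms(1) assms(2-4)[OF that]]
      expectation_mat_trace(2-3)[OF that assms(1) assms(2-4)[OF that], of "p n"]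
    by (simp_all add: T_def)
  have loop: "loop_recursion (T n) (real n) (2 / \<beta>)" if "n \<ge> 1" for n
    unfolding T_def[abs_def] by (rule loop_recursion_beta_ensemble[OF that assms(1) tr(1)[OF that]])
  have odd0: "T n {#p n#} = 0" if "n \<ge> 1" "odd (p n)" for n
    using loop_recursion.odd_degree[OF loop[OF that(1)], of "{#p n#}"] that(2) by simp
  \<comment> \<open>\<open>b (2 * j)\<close> is sqrt pi j^(3/2), the reciprocal of the asymptotics
    of \<open>scat j\<close>, so \<open>real n / b (p n)\<close> is the claimed main term.\<close>
  define b where "b m = sqrt pi * (real m / 2 * sqrt (real m / 2))" for m :: nat
  have b_pos: "b m > 0" if "m > 0" for m using that by (simp add: b_def)
  have factor: "2 powr (3/2) * real n * (pi * real m ^ 3) powr (- (1/2)) = real n / b m" if "m > 0" for n m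
  proof -
    have "(2 :: real) powr (3/2) = 2 powr (1 + 1/2)" by simp
    also have "\<dots> = 2 * sqrt 2" by (simp only: powr_add) (simp add: powr_half_sqrt)
    finally have two: "(2 :: real) powr (3/2) = 2 * sqrt 2" .
    have "(pi * real m ^ 3) powr (- (1/2)) = inverse (sqrt (pi * real m ^ 3))"
      by (simp add: powr_minus powr_half_sqrt)
    moreover have "sqrt (pi * real m ^ 3) = sqrt pi * (real m * sqrt (real m))"
      using real_sqrt_mult[of "real m ^ 2" "real m"]
      by (simp add: real_sqrt_mult power3_eq_cube power2_eq_square)
    ultimately have m: "(pi * real m ^ 3) powr (- (1/2)) = inverse (sqrt pi * (real m * sqrt (real m)))"
      by (simp only:)
    have "b m = sqrt pi * (real m / 2 * (sqrt (real m) / sqrt 2))"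
      by (simp only: b_def real_sqrt_divide)
    also have "\<dots> = sqrt pi * (real m * sqrt (real m)) / (2 * sqrt 2)"
      by (simp only: times_divide_eq_left times_divide_eq_right divide_divide_eq_left mult.assoc)
    finally have b: "b m = sqrt pi * (real m * sqrt (real m)) / (2 * sqrt 2)" .
    have "w * r * inverse X = r / (X / w)" for w r X :: real by (simp add: divide_inverse)
    then show ?thesis unfolding two m b .
  qed
  \<comment> \<open>For even \<open>p n\<close> the value is forced, as the relative error;
    elsewhere 0 keeps the limit undisturbed.\<close>
  define \<delta> where "\<delta> n = (if n \<ge> 1 \<and> even (p n) then T n {#p n#} * b (p n) - 1 else 0)" for n
  have scat_p: "(\<lambda>n. scat (p n div 2) * (sqrt pi * (real (p n div 2) * sqrt (real (p n div 2)))) - 1) \<longlonglongrightarrow> 1 - 1"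
  proof (intro tendsto_diff tendsto_const filterlim_compose[OF scat_asymptotic])
    show "filterlim (\<lambda>n. p n div 2) at_top sequentially"
      by (rule filterlim_compose[OF filterlim_at_top_div_const_nat assms(6)]) simp
  qed
  have size: "(\<lambda>n. real (p n) * sqrt (real (p n)) * (1 + harm (p n))\<^sup>2 / real n) \<longlonglongrightarrow> 0"
    by (rule tendsto_size_condition[OF assms(6-8)])
  \<comment> \<open>The first summand is the error of the Catalan asymptotics, the second the moment
    error \<open>2 / n\<close> multiplied by a bound for \<open>b (p n)\<close>. Both converge along
    all n regardless of parity, since \<open>p n div 2\<close> tends to infinity too.\<close>
  have bound: "(\<lambda>n. \<bar>scat (p n div 2) * (sqrt pi * (real (p n div 2) * sqrt (real (p n div 2)))) - 1\<bar> +
      2 * sqrt pi * (real (p n) * sqrt (real (p n)) * (1 + harm (p n))\<^sup>2 / real n)) \<longlonglongrightarrow> \<bar>1 - 1\<bar> + 2 * sqrt pi * 0"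
    by (intro tendsto_add tendsto_mult tendsto_const tendsto_rabs scat_p size)
  \<comment> \<open>The threshold 1/20 is the hypothesis \<open>large\<close> of
    \<open>even_moment\<close> for \<open>N = p n\<close>.\<close>
  have small: "\<forall>\<^sub>F n in sequentially. real (p n) * sqrt (real (p n)) * (1 + harm (p n))\<^sup>2 / real n < 1 / 20"
    by (rule order_tendstoD(2)[OF size]) simp
  have "\<forall>\<^sub>F n in sequentially. norm (\<delta> n) \<le>
      \<bar>scat (p n div 2) * (sqrt pi * (real (p n div 2) * sqrt (real (p n div 2)))) - 1\<bar> +
      2 * sqrt pi * (real (p n) * sqrt (real (p n)) * (1 + harm (p n))\<^sup>2 / real n)"
    using small eventually_ge_at_top[of 1]
  proof eventually_elim
    case (elim n)
    let ?m = "p n" and ?r = "real (p n) * sqrt (real (p n)) * (1 + harm (p n))\<^sup>2 / real n"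
    have m: "?m \<ge> 1" using assms(5)[of n] elim by simp
    have r_nonneg: "?r \<ge> 0" by simp
    show ?case
    proof (cases "even ?m")
      case True
      then obtain j where j: "?m = 2 * j" by (elim evenE)
      have "20 * (real ?m * sqrt (real ?m) * (1 + harm ?m)\<^sup>2) \<le> real n"
        using elim by (simp add: field_simps)
      then have T: "\<bar>T n {#?m#} - scat j\<bar> \<le> 2 / real n"
        using loop_recursion.even_moment[OF loop[OF elim(2)] m, of j] by (simp add: j)
      have b: "b ?m = sqrt pi * (real j * sqrt (real j))" by (simp add: b_def j)
      have "b ?m \<le> sqrt pi * (real ?m * sqrt (real ?m))"
        unfolding b by (intro mult_left_mono mult_mono) (auto simp: j)
      also have "\<dots> \<le> sqrt pi * (real ?m * sqrt (real ?m) * (1 + harm ?m)\<^sup>2)"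
      proof -
        have "1 \<le> (1 + harm ?m :: real)\<^sup>2" by (intro one_le_power) (simp add: harm_nonneg)
        then have "real ?m * sqrt (real ?m) * 1 \<le> real ?m * sqrt (real ?m) * (1 + harm ?m)\<^sup>2"
          by (rule mult_left_mono) simp
        then show ?thesis by (intro mult_left_mono) simp_all
      qed
      finally have "2 / real n * b ?m \<le> 2 / real n * (sqrt pi * (real ?m * sqrt (real ?m) * (1 + harm ?m)\<^sup>2))"
        by (intro mult_left_mono) auto
      also have "\<dots> = 2 * sqrt pi * ?r" by simp
      finally have bb: "2 / real n * b ?m \<le> 2 * sqrt pi * ?r" .
      have "\<bar>(T n {#?m#} - scat j) * b ?m\<bar> \<le> 2 / real n * b ?m"
      proof -
        have "b ?m > 0" using b_pos m by simp
        then have "\<bar>(T n {#?m#} - scat j) * b ?m\<bar> = \<bar>T n {#?m#} - scat j\<bar> * b ?m"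
          by (simp add: abs_mult)
        also have "\<dots> \<le> 2 / real n * b ?m" using T \<open>b ?m > 0\<close> by (intro mult_right_mono) auto
        finally show ?thesis .
      qed
      moreover have "\<delta> n = (T n {#?m#} - scat j) * b ?m + (scat j * b ?m - 1)"
        using elim True by (simp add: \<delta>_def algebra_simps)
      moreover have "\<bar>(T n {#?m#} - scat j) * b ?m + (scat j * b ?m - 1)\<bar> \<le>
          \<bar>(T n {#?m#} - scat j) * b ?m\<bar> + \<bar>scat j * b ?m - 1\<bar>" by (rule abs_triangle_ineq)
      ultimately have "\<bar>\<delta> n\<bar> \<le> \<bar>scat j * b ?m - 1\<bar> + 2 * sqrt pi * ?r" using bb by linarith
      moreover have "p n div 2 = j" by (simp add: j)
      ultimately show ?thesis by (simp only: real_norm_def b)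
    next
      case False
      have "0 \<le> 2 * sqrt pi * ?r" using r_nonneg by (intro mult_nonneg_nonneg) auto
      then show ?thesis using False by (simp add: \<delta>_def)
    qed
  qed
  then have "\<delta> \<longlonglongrightarrow> 0"
    by (rule Lim_null_comparison) (rule bound[unfolded diff_self abs_zero mult_zero_right add_0_left])
  then have "\<delta> \<in> o(\<lambda>_. 1)" by (intro smalloI_tendsto) auto
  moreover have "integral\<^sup>L (M n) (\<lambda>\<omega>. mat_trace (A n \<omega> ^\<^sub>m p n)) =
      (if even (p n) then complex_of_real
          (2 powr (3/2) * real n * (pi * real (p n) ^ 3) powr (- (1/2)) * (1 + \<delta> n)) else 0)" if n: "n \<ge> 1" for n
  proof (cases "even (p n)")
    case True
    have "real n * T n {#p n#} = real n / b (p n) * (1 + \<delta> n)"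
      using n True b_pos[of "p n"] assms(5)[OF n] by (simp add: \<delta>_def)
    then show ?thesis using True by (simp only: tr(3)[OF n] factor[OF assms(5)[OF n]] if_True)
  next
    case False
    then show ?thesis using tr(3)[OF n] odd0[OF n] by simp
  qed
  ultimately show ?thesis using tr(2) by blast
qed

end
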